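(* For $j=1,2$, let $F_j\in C^2(\mathbb{R})$ be non-increasing with $F_j(0)=0$, and for $\delta\in[0,1]$ let $u_{j,\delta}\in C^{2+\alpha}(\overline{\Omega})$ be the solution of $$-|a|^{\frac12}\sum_{i,k=1}^n \partial_{x_i}\left(|a|^{-\frac12}a_{i,k}\,\partial_{x_k}u_{j,\delta}\right)=F_j(u_{j,\delta})\ \text{in }\Omega,\qquad u_{j,\delta}=\delta g\ \text{on }\partial\Omega.$$ Then, for any $x_0\in\partial\Omega$ and any $\delta_0\in(0,1]$, the condition $$\partial_{\nu_a}u_{1,\delta}(x_0)=\partial_{\nu_a}u_{2,\delta}(x_0)\quad\text{for all }\delta\in[0,\delta_0]$$ implies that at least one of the following holds: (i) the map $F=F_1-F_2$ changes sign an infinite number of times on $[0,\delta_0R]$; (ii) $F_1=F_2$ on $[0,\delta_0R]$.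
   Context: Let $n\ge2$, $\alpha\in(0,1)$, and let $\Omega\subset\mathbb{R}^n$ be a bounded connected domain with $C^{2+\alpha}$ boundary. Let $a=(a_{i,j})_{1\le i,j\le n}\in C^2(\overline{\Omega};\mathbb{R}^{n^2})$ be symmetric ($a_{i,j}=a_{j,i}$) and elliptic: there is $c>0$ with $\sum_{i,j}a_{i,j}(x)\xi_i\xi_j\ge c|\xi|^2$ for all $x\in\overline\Omega$, $\xi\in\mathbb{R}^n$. $|a|$ denotes the absolute value of the determinant of $a$. Let $g\in C^{2+\alpha}(\partial\Omega)$ satisfy $g(\partial\Omega)=[0,R]$ with $R>0$. For non-increasing $F\in C^1(\mathbb{R})$ with $F(0)=0$, the boundary value problem with source $F(u)$ and Dirichlet data $\delta g$ has a unique solution in $C^{2+\alpha}(\overline\Omega)$ for every $\delta\in[0,1]$. With $\nu$ the outward unit normal to $\partial\Omega$, $\partial_{\nu_a}v(x)=\sum_{i,j=1}^n a_{i,j}(x)\,\partial_{x_j}v(x)\,\nu_i(x)$ for $x\in\partial\Omega$. A function $F$ changes sign an infinite number of times on an interval $I$ if for every $m\in\mathbb{N}$ there are points $t_0<t_1<\dots<t_m$ in $I$ with $F(t_{i-1})F(t_i)<0$ for $i=1,\dots,m$. *)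

theory Defs
  imports "HOL-Analysis.Analysis"
begin

definition partial :: "'n::finite \<Rightarrow> (real^'n \<Rightarrow> real) \<Rightarrow> real^'n \<Rightarrow> real" where
  "partial i f x = deriv (\<lambda>t. f (x + t *\<^sub>R axis i 1)) 0"

text \<open>For open \<open>\<Omega>\<close> the next two predicates describe the classes \<open>C^k\<close> and \<open>C^(k+\<alpha>)\<close> on the
  closure of \<open>\<Omega>\<close>: the function is continuous on the closure, and each partial derivative
  up to order \<open>k\<close> exists in \<open>\<Omega>\<close> and extends continuously to the closure, the derivatives of
  order \<open>k\<close> being moreover uniformly \<open>\<alpha>\<close>-Hoelder in the second case. The function \<open>h\<close> is the
  extension of the \<open>i\<close>-th partial derivative; on the closure it is unique.\<close>

primrec C_closure :: "nat \<Rightarrow> (real^'n::finite) set \<Rightarrow> (real^'n \<Rightarrow> real) \<Rightarrow> bool" where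
  "C_closure 0 \<Omega> f \<longleftrightarrow> continuous_on (closure \<Omega>) f"
| "C_closure (Suc k) \<Omega> f \<longleftrightarrow> continuous_on (closure \<Omega>) f \<and>
     (\<forall>i. \<exists>h. C_closure k \<Omega> h \<and>
       (\<forall>x\<in>\<Omega>. ((\<lambda>t. f (x + t *\<^sub>R axis i 1)) has_real_derivative h x) (at 0)))"

primrec C_holder_closure ::
    "nat \<Rightarrow> real \<Rightarrow> (real^'n::finite) set \<Rightarrow> (real^'n \<Rightarrow> real) \<Rightarrow> bool" where
  "C_holder_closure 0 \<alpha> \<Omega> f \<longleftrightarrow> continuous_on (closure \<Omega>) f \<and>
     (\<exists>C. \<forall>x\<in>closure \<Omega>. \<forall>y\<in>closure \<Omega>. \<bar>f x - f y\<bar> \<le> C * dist x y powr \<alpha>)"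
| "C_holder_closure (Suc k) \<alpha> \<Omega> f \<longleftrightarrow> continuous_on (closure \<Omega>) f \<and>
     (\<forall>i. \<exists>h. C_holder_closure k \<alpha> \<Omega> h \<and>
       (\<forall>x\<in>\<Omega>. ((\<lambda>t. f (x + t *\<^sub>R axis i 1)) has_real_derivative h x) (at 0)))"

definition C2_real :: "(real \<Rightarrow> real) \<Rightarrow> bool" where
  "C2_real F \<longleftrightarrow> (\<exists>F' F''. (\<forall>t. (F has_real_derivative F' t) (at t)) \<and>
     (\<forall>t. (F' has_real_derivative F'' t) (at t)) \<and> continuous_on UNIV F'')"

text \<open>Near \<open>p\<close> the set \<open>\<Omega>\<close> lies on one side of the graph, in the direction of the \<open>k\<close>-th
  coordinate, of a \<open>C^(2+\<alpha>)\<close> function \<open>\<gamma>\<close> of the remaining coordinates. Such a function is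
  encoded as a function on \<open>real^'n\<close> which does not depend on the \<open>k\<close>-th coordinate; the sign
  \<open>\<sigma>\<close> accounts for the orientation of the \<open>k\<close>-th axis.\<close>

definition boundary_graph ::
    "real \<Rightarrow> (real^'n::finite) set \<Rightarrow> real^'n \<Rightarrow> real \<Rightarrow> 'n \<Rightarrow> real \<Rightarrow> (real^'n \<Rightarrow> real) \<Rightarrow> bool" where
  "boundary_graph \<alpha> \<Omega> p r k \<sigma> \<gamma> \<longleftrightarrow>
     0 < r \<and> \<sigma> \<in> {-1, 1} \<and>
     C_holder_closure 2 \<alpha> (ball p r) \<gamma> \<and>
     (\<forall>x\<in>ball p r. \<forall>y\<in>ball p r. (\<forall>j. j \<noteq> k \<longrightarrow> x $ j = y $ j) \<longrightarrow> \<gamma> x = \<gamma> y) \<and>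
     \<Omega> \<inter> ball p r = {x \<in> ball p r. 0 < \<sigma> * (x $ k - \<gamma> x)}"

definition C2_holder_boundary :: "real \<Rightarrow> (real^'n::finite) set \<Rightarrow> bool" where
  "C2_holder_boundary \<alpha> \<Omega> \<longleftrightarrow>
     (\<forall>p\<in>frontier \<Omega>. \<exists>r k \<sigma> \<gamma>. boundary_graph \<alpha> \<Omega> p r k \<sigma> \<gamma>)"

text \<open>Functions of class \<open>C^(2+\<alpha>)\<close> on the boundary: \<open>g\<close> is \<open>C^(2+\<alpha>)\<close> in local graph
  coordinates. The radius \<open>s\<close> allows for points of \<open>ball p r\<close> above or below which
  the graph leaves the ball, hence possibly the boundary.\<close>

definition C2_holder_on_boundary ::
    "real \<Rightarrow> (real^'n::finite) set \<Rightarrow> (real^'n \<Rightarrow> real) \<Rightarrow> bool" where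
  "C2_holder_on_boundary \<alpha> \<Omega> g \<longleftrightarrow>
     (\<forall>p\<in>frontier \<Omega>. \<exists>r k \<sigma> \<gamma> s. boundary_graph \<alpha> \<Omega> p r k \<sigma> \<gamma> \<and> 0 < s \<and> s \<le> r \<and>
        C_holder_closure 2 \<alpha> (ball p s) (\<lambda>x. g (\<chi> j. if j = k then \<gamma> x else x $ j)))"

text \<open>A unit vector that is orthogonal to all velocities at \<open>x\<close> of curves in the boundary,
  that is, to the tangent space, and that points out of \<open>\<Omega>\<close>.\<close>

definition outward_unit_normal :: "(real^'n::finite) set \<Rightarrow> real^'n \<Rightarrow> real^'n \<Rightarrow> bool" where
  "outward_unit_normal \<Omega> x N \<longleftrightarrow>
     norm N = 1 \<and>
     (\<forall>c w. c 0 = x \<and> (\<forall>t. c t \<in> frontier \<Omega>) \<and> (c has_vector_derivative w) (at 0)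
        \<longrightarrow> N \<bullet> w = 0) \<and>
     (\<exists>\<epsilon>>0. \<forall>t\<in>{0<..<\<epsilon>}. x + t *\<^sub>R N \<notin> closure \<Omega> \<and> x - t *\<^sub>R N \<in> \<Omega>)"

text \<open>At boundary points, derivatives of functions in \<open>C^1\<close> of the closure are the limits of
  the derivatives taken inside \<open>\<Omega>\<close>.\<close>

definition conormal_derivative ::
    "(real^'n \<Rightarrow> real^'n^'n) \<Rightarrow> (real^'n::finite) set \<Rightarrow> (real^'n \<Rightarrow> real^'n)
       \<Rightarrow> (real^'n \<Rightarrow> real) \<Rightarrow> real^'n \<Rightarrow> real" where
  "conormal_derivative a \<Omega> \<nu> v x =
     (\<Sum>i\<in>UNIV. \<Sum>j\<in>UNIV. a x $ i $ j * Lim (at x within \<Omega>) (partial j v) * \<nu> x $ i)"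

definition div_operator ::
    "(real^'n \<Rightarrow> real^'n^'n) \<Rightarrow> (real^'n::finite \<Rightarrow> real) \<Rightarrow> real^'n \<Rightarrow> real" where
  "div_operator a u x =
     - (\<bar>det (a x)\<bar> powr (1/2) *
        (\<Sum>i\<in>UNIV. \<Sum>k\<in>UNIV.
           partial i (\<lambda>y. \<bar>det (a y)\<bar> powr (-1/2) * a y $ i $ k * partial k u y) x))"

definition solves_dirichlet ::
    "real \<Rightarrow> (real^'n \<Rightarrow> real^'n^'n) \<Rightarrow> (real^'n::finite) set \<Rightarrow> (real \<Rightarrow> real)
       \<Rightarrow> (real^'n \<Rightarrow> real) \<Rightarrow> (real^'n \<Rightarrow> real) \<Rightarrow> bool" where
  "solves_dirichlet \<alpha> a \<Omega> F h u \<longleftrightarrow>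
     C_holder_closure 2 \<alpha> \<Omega> u \<and>
     (\<forall>x\<in>\<Omega>. div_operator a u x = F (u x)) \<and>
     (\<forall>x\<in>frontier \<Omega>. u x = h x)"

definition changes_sign_infinitely_often :: "(real \<Rightarrow> real) \<Rightarrow> real set \<Rightarrow> bool" where
  "changes_sign_infinitely_often F I \<longleftrightarrow>
     (\<forall>m::nat. \<exists>t::nat \<Rightarrow> real. (\<forall>i\<le>m. t i \<in> I) \<and>
        (\<forall>i\<in>{1..m}. t (i - 1) < t i \<and> F (t (i - 1)) * F (t i) < 0))"

end

theory Submission
  imports Defs
begin

text \<open>
  Suppose that \<open>F = F\<^sub>1 - F\<^sub>2\<close> has finitely many sign changes on \<open>[0, \<delta>\<^sub>0 R]\<close> and does not vanish
  identically there. Then, for some \<open>s\<close>, \<open>F\<close> has one sign on \<open>[0, s]\<close> without vanishing identically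
  on it (\<open>one_sign_near_zero\<close>). By symmetry let \<open>F \<ge> 0\<close> on \<open>[0, s]\<close>, and put \<open>\<delta> = s / R\<close>, so that the boundary data
  \<open>\<delta> g\<close> take exactly the values in \<open>[0, s]\<close>. It turns out that the conormal derivatives of the
  two solutions \<open>u\<^sub>1\<close>, \<open>u\<^sub>2\<close> for this single \<open>\<delta>\<close> differ at every boundary point
  (\<open>conormal_derivatives_differ\<close>).

  Written in nondivergence form, the operator is \<open>-L\<close> with \<open>L v = a : D\<^sup>2 v + b \<bullet> \<nabla>v\<close>, where \<open>b\<close> is
  bounded (\<open>div_operator_nondivergence_form\<close>). As the \<open>F\<^sub>j\<close> are non-increasing and vanish at \<open>0\<close>, the weak
  minimum principle gives \<open>0 \<le> u\<^sub>j \<le> s\<close> (\<open>solution_bounds\<close>). The difference \<open>w = u\<^sub>1 - u\<^sub>2\<close> vanishes on the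
  boundary and satisfies
  \<open>- L w = (F\<^sub>1(u\<^sub>1) - F\<^sub>1(u\<^sub>2)) + F(u\<^sub>2)\<close> with \<open>F(u\<^sub>2) \<ge> 0\<close>. By monotonicity of \<open>F\<^sub>1\<close>, the weak principle
  gives \<open>w \<ge> 0\<close>, and a Lipschitz constant \<open>Q\<close> of \<open>F\<^sub>1\<close> on \<open>[0, s]\<close> gives \<open>L w \<le> Q w\<close>. If \<open>w\<close> vanished
  identically then so would \<open>F(u\<^sub>2)\<close>; but on the boundary \<open>u\<^sub>2\<close> takes every value in \<open>[0, s]\<close>, and
  \<open>F\<close> is nonzero somewhere there. Hence \<open>w > 0\<close> in the domain by the strong minimum principle, and Hopf's lemma
  (\<open>hopf_gradient\<close>), in an interior ball at \<open>x\<^sub>0\<close>, gives \<open>\<nabla>w(x\<^sub>0) \<noteq> 0\<close>.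

  It remains to see that \<open>\<nabla>w(x\<^sub>0)\<close> is a multiple of \<open>\<nu>\<close>, for then ellipticity makes
  \<open>\<nu> \<bullet> a \<nabla>w\<close> nonzero. The graph representation of the boundary supplies a normal vector \<open>N\<close>
  (\<open>boundary_graph_normal\<close>). Along every ray that enters the domain, \<open>w\<close> grows from \<open>0\<close>, so
  \<open>\<nabla>w(x\<^sub>0) \<bullet> d \<ge> 0\<close> whenever \<open>N \<bullet> d > 0\<close>, and therefore \<open>\<nabla>w(x\<^sub>0)\<close> is parallel to \<open>N\<close>. The vector \<open>\<nu>\<close> is
  orthogonal to all curves in the boundary, so it is parallel to \<open>N\<close> as well.
\<close>

section \<open>Sign changes\<close>

text \<open>Otherwise, below every point where \<open>f\<close> is nonzero there is one where \<open>f\<close> has the opposite sign. As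
  \<open>f 0 = 0\<close>, this descent never stops, and it produces alternating sequences of every length.\<close>

lemma one_sign_near_zero:
  fixes f :: "real \<Rightarrow> real"
  assumes "f 0 = 0" and nosc: "\<not> changes_sign_infinitely_often f {0..T}"
    and "t \<in> {0..T}" "f t \<noteq> 0"
  obtains s where "0 < s" "s \<le> T" "\<exists>t\<in>{0..s}. f t \<noteq> 0"
    "(\<forall>t\<in>{0..s}. 0 \<le> f t) \<or> (\<forall>t\<in>{0..s}. f t \<le> 0)"
proof (rule ccontr)
  note witness = that
  assume "\<not> thesis"
  then have no: "\<not> ((\<forall>t\<in>{0..s}. 0 \<le> f t) \<or> (\<forall>t\<in>{0..s}. f t \<le> 0))"
    if "0 < s" "s \<le> T" "\<exists>t\<in>{0..s}. f t \<noteq> 0" for s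
    using witness that by blast
  have both: "\<exists>q\<in>{0..<p}. f q * f p < 0" if "p \<in> {0..T}" "f p \<noteq> 0" for p
  proof -
    have "p > 0" using that \<open>f 0 = 0\<close> by (cases "p = 0") auto
    then have "\<not> ((\<forall>t\<in>{0..p}. 0 \<le> f t) \<or> (\<forall>t\<in>{0..p}. f t \<le> 0))"
      using that by (intro no) (auto intro!: bexI[of _ p])
    then obtain q1 q2 where q: "q1 \<in> {0..p}" "f q1 < 0" "q2 \<in> {0..p}" "0 < f q2"
      by (auto simp: not_le)
    have "f q * f p < 0 \<Longrightarrow> q \<noteq> p" for q by (auto simp: mult_less_0_iff)
    then show ?thesis
      using q that by (cases "0 < f p") (force simp: mult_less_0_iff)+
  qed
  have "\<exists>t. (\<forall>i\<le>m. t i \<in> {0..T}) \<and> f (t 0) \<noteq> 0 \<and>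
          (\<forall>i\<in>{1..m}. t (i - 1) < t i \<and> f (t (i - 1)) * f (t i) < 0)" for m :: nat
  proof (induction m)
    case 0
    then show ?case using assms by (intro exI[of _ "\<lambda>_. t"]) auto
  next
    case (Suc m)
    then obtain t where t: "\<forall>i\<le>m. t i \<in> {0..T}" "f (t 0) \<noteq> 0"
      "\<forall>i\<in>{1..m}. t (i - 1) < t i \<and> f (t (i - 1)) * f (t i) < 0" by blast
    obtain q where q: "q \<in> {0..<t 0}" "f q * f (t 0) < 0"
      using both[of "t 0"] t by auto
    define t' where "t' = (\<lambda>i. case i of 0 \<Rightarrow> q | Suc j \<Rightarrow> t j)"
    have "t' i \<in> {0..T}" if "i \<le> Suc m" for i
      using that t(1) q by (cases i) (force simp: t'_def)+
    moreover have "f (t' 0) \<noteq> 0" using q by (auto simp: t'_def)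
    moreover have "t' (i - 1) < t' i \<and> f (t' (i - 1)) * f (t' i) < 0" if "i \<in> {1..Suc m}" for i
    proof -
      obtain j where j: "i = Suc j" "j \<le> m" using \<open>i \<in> {1..Suc m}\<close> by (cases i) auto
      show ?thesis
      proof (cases j)
        case 0
        then show ?thesis using j q by (simp add: t'_def)
      next
        case (Suc k)
        then show ?thesis using j t(3)[rule_format, of j] by (simp add: t'_def)
      qed
    qed
    ultimately show ?case by (intro exI[of _ t']) auto
  qed
  then have "changes_sign_infinitely_often f {0..T}"
    unfolding changes_sign_infinitely_often_def by blast
  then show False using nosc by blast
qed

section \<open>Gradients and Hessians\<close>

text \<open>The functions are differentiable in the sense of Frechet, twice, so that derivatives along all
  lines can be used, not only along the axes. The row \<open>H x $ i\<close> is the gradient of the \<open>i\<close>-th component of \<open>G\<close>.\<close>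

definition has_grad_hess ::
    "(real^'n::finite) set \<Rightarrow> (real^'n \<Rightarrow> real) \<Rightarrow> (real^'n \<Rightarrow> real^'n) \<Rightarrow> (real^'n \<Rightarrow> real^'n^'n) \<Rightarrow> bool"
  where "has_grad_hess D w G H \<longleftrightarrow>
     (\<forall>x\<in>D. (w has_derivative (\<lambda>v. G x \<bullet> v)) (at x) \<and> (G has_derivative (\<lambda>v. H x *v v)) (at x))"

text \<open>The increment is telescoped into steps along the axes. Each step is controlled by the mean value
  inequality for the function minus its linear part, whose derivative is small by continuity of the partials.\<close>

lemma continuous_partials_imp_has_derivative:
  fixes f :: "real^'n::finite \<Rightarrow> real"
  assumes "open D" "x \<in> D"
    and part: "\<And>i z. z \<in> D \<Longrightarrow> ((\<lambda>t. f (z + t *\<^sub>R axis i 1)) has_real_derivative h i z) (at 0)"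
    and cont: "\<And>i. continuous_on D (h i)"
  shows "(f has_derivative (\<lambda>v. (\<chi> i. h i x) \<bullet> v)) (at x)"
  unfolding has_derivative_at_alt
proof (intro conjI allI impI)
  show "bounded_linear (\<lambda>v. (\<chi> i. h i x) \<bullet> v)" by (rule bounded_linear_inner_right)
  fix e :: real assume "0 < e"
  define e' where "e' = e / CARD('n)"
  have "e' > 0" using \<open>0 < e\<close> by (simp add: e'_def)
  have "\<exists>d>0. \<forall>z\<in>ball x d. z \<in> D \<and> \<bar>h i z - h i x\<bar> \<le> e'" for i
  proof -
    have "isCont (h i) x"
      using assms continuous_on_eq_continuous_at by blast
    then obtain d1 where d1: "d1 > 0" "\<And>z. dist z x < d1 \<Longrightarrow> dist (h i z) (h i x) < e'"
      using \<open>e' > 0\<close> by (metis continuous_at_eps_delta)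
    obtain d2 where d2: "d2 > 0" "ball x d2 \<subseteq> D"
      using assms open_contains_ball by blast
    show ?thesis
      using d1 d2 by (intro exI[of _ "min d1 d2"]) (auto simp: dist_commute dist_real_def subset_iff less_imp_le)
  qed
  then obtain dd where dd: "\<And>i. dd i > 0" "\<And>i z. z \<in> ball x (dd i) \<Longrightarrow> z \<in> D \<and> \<bar>h i z - h i x\<bar> \<le> e'"
    by metis
  define d where "d = Min (range dd)"
  have "d > 0" using dd by (simp add: d_def)
  have d: "z \<in> D" "\<bar>h i z - h i x\<bar> \<le> e'" if "z \<in> ball x d" for i z
  proof -
    have "d \<le> dd i" by (simp add: d_def)
    then show "z \<in> D" "\<bar>h i z - h i x\<bar> \<le> e'" using dd(2)[of z i] that by auto
  qed
  define P where "P = (\<lambda>S v. (\<chi> j. if j \<in> S then v $ j else 0) :: real^'n)"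
  have "norm (f y - f x - (\<chi> i. h i x) \<bullet> (y - x)) \<le> e * norm (y - x)" if "norm (y - x) < d" for y
  proof -
    define v where "v = y - x"
    \<comment> \<open>\<open>P S v\<close> is \<open>v\<close> with the coordinates outside \<open>S\<close> set to zero; the coordinates are
    switched on one at a time.\<close>
    have tel: "\<bar>f (x + P S v) - f x - (\<Sum>i\<in>S. h i x * v $ i)\<bar> \<le> (\<Sum>i\<in>S. e' * \<bar>v $ i\<bar>)" if "finite S" for S
      using that
    proof (induction S)
      case empty
      have "P {} v = 0" by (simp add: P_def vec_eq_iff)
      then show ?case by simp
    next
      case (insert i S)
      define z where "z = x + P S v"
      have eqz: "x + P (insert i S) v = z + (v $ i) *\<^sub>R axis i 1"
        using insert by (auto simp: z_def P_def vec_eq_iff axis_def)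
      have inb: "z + t *\<^sub>R axis i 1 \<in> ball x d" if "t \<in> closed_segment 0 (v $ i)" for t
      proof -
        have "\<bar>t\<bar> \<le> \<bar>v $ i\<bar>" using that
          by (auto simp: closed_segment_eq_real_ivl split: if_splits)
        then have "norm (P S v + t *\<^sub>R axis i 1) \<le> norm v"
          using insert by (intro norm_le_componentwise_cart) (auto simp: P_def axis_def)
        then have "norm (P S v + t *\<^sub>R axis i 1) < d"
          using \<open>norm (y - x) < d\<close> by (simp add: v_def)
        moreover have "dist x (z + t *\<^sub>R axis i 1) = norm (P S v + t *\<^sub>R axis i 1)"
          unfolding z_def dist_norm by (subst norm_minus_commute) (simp add: add.assoc)
        ultimately show ?thesis by simp
      qed
      have "norm ((f (z + (v $ i) *\<^sub>R axis i 1) - v $ i * h i x) - (f (z + 0 *\<^sub>R axis i 1) - 0 * h i x))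
             \<le> e' * norm (v $ i - 0)"
      proof (rule field_differentiable_bound[where S = "closed_segment 0 (v $ i)"
              and f = "\<lambda>t. f (z + t *\<^sub>R axis i 1) - t * h i x" and f' = "\<lambda>t. h i (z + t *\<^sub>R axis i 1) - h i x"])
        fix t assume t: "t \<in> closed_segment 0 (v $ i)"
        have "((\<lambda>s. f ((z + t *\<^sub>R axis i 1) + s *\<^sub>R axis i 1)) has_real_derivative h i (z + t *\<^sub>R axis i 1)) (at 0)"
          using part d(1) inb[OF t] by blast
        then have "((\<lambda>s. f (z + (s + t) *\<^sub>R axis i 1)) has_real_derivative h i (z + t *\<^sub>R axis i 1)) (at 0)"
          by (simp add: algebra_simps)
        then have "((\<lambda>s. f (z + s *\<^sub>R axis i 1)) has_real_derivative h i (z + t *\<^sub>R axis i 1)) (at t)"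
          using DERIV_shift[of "\<lambda>s. f (z + s *\<^sub>R axis i 1)" _ 0 t] by simp
        then show "((\<lambda>t. f (z + t *\<^sub>R axis i 1) - t * h i x) has_field_derivative
               h i (z + t *\<^sub>R axis i 1) - h i x) (at t within closed_segment 0 (v $ i))"
          by (auto intro!: derivative_eq_intros intro: has_field_derivative_at_within)
        show "norm (h i (z + t *\<^sub>R axis i 1) - h i x) \<le> e'"
          using d(2) inb[OF t] by simp
      qed auto
      then have "\<bar>f (x + P (insert i S) v) - f z - h i x * v $ i\<bar> \<le> e' * \<bar>v $ i\<bar>"
        by (simp add: eqz algebra_simps)
      then show ?case using insert by (simp add: z_def)
    qed
    have "P UNIV v = v" by (simp add: P_def vec_eq_iff)
    then have "\<bar>f y - f x - (\<chi> i. h i x) \<bullet> v\<bar> \<le> (\<Sum>i\<in>UNIV. e' * \<bar>v $ i\<bar>)"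
      using tel[of UNIV] by (simp add: v_def inner_vec_def)
    also have "\<dots> \<le> (\<Sum>i::'n\<in>UNIV. e' * norm v)"
      using \<open>e' > 0\<close> by (intro sum_mono mult_left_mono component_le_norm_cart) auto
    also have "\<dots> = e * norm v" by (simp add: e'_def)
    finally show ?thesis by (simp add: v_def)
  qed
  then show "\<exists>d>0. \<forall>y. norm (y - x) < d \<longrightarrow>
       norm (f y - f x - (\<chi> i. h i x) \<bullet> (y - x)) \<le> e * norm (y - x)"
    using \<open>d > 0\<close> by blast
qed

lemma C_holder_closure_2_grad_hess:
  fixes u :: "real^'n::finite \<Rightarrow> real"
  assumes "open D" "C_holder_closure 2 \<alpha> D u"
  obtains G H where "continuous_on (closure D) u" "continuous_on (closure D) G"
    "\<And>i j. continuous_on (closure D) (\<lambda>x. H x $ i $ j)" "has_grad_hess D u G H"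
proof -
  have "\<exists>h. continuous_on (closure D) u \<and> (\<forall>i. C_holder_closure (Suc 0) \<alpha> D (h i)) \<and>
      (\<forall>i. \<forall>x\<in>D. ((\<lambda>t. u (x + t *\<^sub>R axis i 1)) has_real_derivative h i x) (at 0))"
    using assms(2) unfolding numeral_2_eq_2 C_holder_closure.simps(2)[of "Suc 0"] by metis
  then obtain h where cu: "continuous_on (closure D) u"
    and h: "\<And>i. C_holder_closure (Suc 0) \<alpha> D (h i)"
    and hd: "\<And>i x. x \<in> D \<Longrightarrow> ((\<lambda>t. u (x + t *\<^sub>R axis i 1)) has_real_derivative h i x) (at 0)"
    by blast
  have ch: "continuous_on (closure D) (h i)" for i using h[of i] by simp
  have "\<exists>k. \<forall>j. continuous_on (closure D) (k j) \<and>
      (\<forall>x\<in>D. ((\<lambda>t. h i (x + t *\<^sub>R axis j 1)) has_real_derivative k j x) (at 0))" for i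
    using h[of i] by simp metis
  then obtain k where k: "\<And>i j. continuous_on (closure D) (k i j)"
    and kd: "\<And>i j x. x \<in> D \<Longrightarrow> ((\<lambda>t. h i (x + t *\<^sub>R axis j 1)) has_real_derivative k i j x) (at 0)"
    by metis
  have sub: "continuous_on D f" if "continuous_on (closure D) f" for f :: "real^'n \<Rightarrow> real"
    using that closure_subset continuous_on_subset by blast
  define G where "G = (\<lambda>x. \<chi> i. h i x)"
  define H where "H = (\<lambda>x. \<chi> i j. k i j x)"
  have "(u has_derivative (\<lambda>v. G x \<bullet> v)) (at x)" if "x \<in> D" for x
    unfolding G_def by (rule continuous_partials_imp_has_derivative[OF \<open>open D\<close> that hd]) (auto intro: sub ch)
  moreover have "(G has_derivative (\<lambda>v. H x *v v)) (at x)" if "x \<in> D" for x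
  proof -
    have "(h i has_derivative (\<lambda>v. (\<chi> j. k i j x) \<bullet> v)) (at x)" for i
      by (rule continuous_partials_imp_has_derivative[OF \<open>open D\<close> that kd]) (auto intro: sub k)
    then show ?thesis
      unfolding G_def H_def
      by (subst has_derivative_componentwise_within)
         (auto simp: Basis_vec_def inner_axis matrix_vector_mul_component)
  qed
  ultimately have "has_grad_hess D u G H" by (simp add: has_grad_hess_def)
  moreover have "continuous_on (closure D) G"
    unfolding G_def by (intro continuous_on_vec_lambda ch)
  moreover have "continuous_on (closure D) (\<lambda>x. H x $ i $ j)" for i j
    by (simp add: H_def k)
  ultimately show ?thesis using cu that by blast
qed

lemma has_derivative_along_line:
  fixes w :: "real^'n::finite \<Rightarrow> real"
  assumes "(w has_derivative (\<lambda>v. G \<bullet> v)) (at (x + t *\<^sub>R d))"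
  shows "((\<lambda>t. w (x + t *\<^sub>R d)) has_real_derivative G \<bullet> d) (at t)"
proof -
  have "((\<lambda>t. x + t *\<^sub>R d) has_derivative (\<lambda>s. s *\<^sub>R d)) (at t)"
    by (auto intro!: derivative_eq_intros)
  from has_derivative_compose[OF this assms]
  show ?thesis by (rule has_derivative_imp_has_field_derivative) simp
qed

text \<open>A negative second derivative along \<open>\<xi>\<close> would make the first derivative, which is zero at \<open>x\<close>,
  negative just after \<open>x\<close>, so that \<open>w\<close> would decrease there.\<close>

lemma interior_min_grad_hess:
  fixes w :: "real^'n::finite \<Rightarrow> real"
  assumes "open D" "x \<in> D" "has_grad_hess D w G H" and min: "\<And>y. y \<in> D \<Longrightarrow> w x \<le> w y"
  shows "G x = 0" "0 \<le> \<xi> \<bullet> (H x *v \<xi>)"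
proof -
  have dw: "(w has_derivative (\<lambda>v. G y \<bullet> v)) (at y)"
    and dG: "(G has_derivative (\<lambda>v. H y *v v)) (at y)" if "y \<in> D" for y
    using assms(3) that by (auto simp: has_grad_hess_def)
  have "(\<lambda>v. G x \<bullet> v) = (\<lambda>v. 0)"
    using differential_zero_maxmin[OF \<open>x \<in> D\<close> \<open>open D\<close> dw[OF \<open>x \<in> D\<close>]] min by blast
  then have "G x \<bullet> G x = 0" by metis
  then show G0: "G x = 0" by simp
  show "0 \<le> \<xi> \<bullet> (H x *v \<xi>)"
  proof (rule ccontr)
    assume "\<not> 0 \<le> \<xi> \<bullet> (H x *v \<xi>)"
    then have neg: "\<xi> \<bullet> (H x *v \<xi>) < 0" by simp
    obtain e where "e > 0" and e: "ball x e \<subseteq> D" using assms open_contains_ball by blast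
    define T where "T = e / (norm \<xi> + 1)"
    have "T > 0" using \<open>e > 0\<close> unfolding T_def by (intro divide_pos_pos) (auto simp: add_nonneg_pos)
    have inD: "x + t *\<^sub>R \<xi> \<in> D" if "0 \<le> t" "t < T" for t
    proof -
      have "t * (norm \<xi> + 1) < e" using that unfolding T_def
        by (simp add: pos_less_divide_eq add_nonneg_pos)
      then have "t * norm \<xi> < e" using that by (simp add: algebra_simps)
      then show ?thesis using e that by (auto simp: dist_norm subset_iff)
    qed
    have "((\<lambda>t. G (x + t *\<^sub>R \<xi>)) has_derivative (\<lambda>s. H x *v (s *\<^sub>R \<xi>))) (at 0)"
    proof -
      have "((\<lambda>t. x + t *\<^sub>R \<xi>) has_derivative (\<lambda>s. s *\<^sub>R \<xi>)) (at 0)"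
        by (auto intro!: derivative_eq_intros)
      then show ?thesis
        by (rule has_derivative_compose) (use dG[OF \<open>x \<in> D\<close>] in simp)
    qed
    then have "((\<lambda>t. \<xi> \<bullet> G (x + t *\<^sub>R \<xi>)) has_derivative (\<lambda>s. \<xi> \<bullet> (H x *v (s *\<^sub>R \<xi>)))) (at 0)"
      by (rule has_derivative_inner_right)
    then have "((\<lambda>t. \<xi> \<bullet> G (x + t *\<^sub>R \<xi>)) has_real_derivative \<xi> \<bullet> (H x *v \<xi>)) (at 0)"
      by (rule has_derivative_imp_has_field_derivative) (simp add: matrix_vector_mult_scaleR)
    from DERIV_neg_dec_right[OF this neg]
    obtain d where d: "d > 0" "\<And>h. 0 < h \<Longrightarrow> h < d \<Longrightarrow> \<xi> \<bullet> G (x + h *\<^sub>R \<xi>) < 0"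
      using G0 by auto
    define t where "t = min d T / 2"
    have t: "0 < t" "t < d" "t < T" using d \<open>T > 0\<close> by (auto simp: t_def)
    have "\<exists>z>0. z < t \<and> w (x + t *\<^sub>R \<xi>) - w (x + 0 *\<^sub>R \<xi>) = (t - 0) * (G (x + z *\<^sub>R \<xi>) \<bullet> \<xi>)"
      using MVT2[of 0 t "\<lambda>t. w (x + t *\<^sub>R \<xi>)" "\<lambda>t. G (x + t *\<^sub>R \<xi>) \<bullet> \<xi>"] t inD
      by (force intro!: has_derivative_along_line dw)
    then obtain z where z: "0 < z" "z < t" "w (x + t *\<^sub>R \<xi>) - w x = t * (G (x + z *\<^sub>R \<xi>) \<bullet> \<xi>)"
      by auto
    have "t * (G (x + z *\<^sub>R \<xi>) \<bullet> \<xi>) < 0"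
      using d(2)[of z] z t by (simp add: mult_less_0_iff inner_commute)
    then show False using min[OF inD[of t]] z t by auto
  qed
qed

text \<open>A one-sided difference quotient bound passes to the limit \<open>p\<close> of the gradients by the mean value theorem. The
  point \<open>x\<close> may lie on the boundary of the set \<open>S\<close> in which \<open>w\<close> is differentiable.\<close>

lemma le_directional_derivative:
  fixes w :: "real^'n::finite \<Rightarrow> real"
  assumes "continuous_on D w" "(G \<longlongrightarrow> p) (at x within S)"
    and der: "\<And>y. y \<in> S \<Longrightarrow> (w has_derivative (\<lambda>v. G y \<bullet> v)) (at y)"
    and "0 < T" and seg: "\<And>t. 0 < t \<Longrightarrow> t \<le> T \<Longrightarrow> x + t *\<^sub>R d \<in> S - {x}" and "S \<subseteq> D" "x \<in> D"
    and growth: "\<And>t. 0 < t \<Longrightarrow> t \<le> T \<Longrightarrow> w x + \<kappa> * t \<le> w (x + t *\<^sub>R d)"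
  shows "\<kappa> \<le> p \<bullet> d"
proof (rule ccontr)
  assume "\<not> \<kappa> \<le> p \<bullet> d"
  have "filterlim (\<lambda>t. x + t *\<^sub>R d) (at x within S) (at_right 0)"
    unfolding filterlim_at
  proof
    show "\<forall>\<^sub>F t in at_right 0. x + t *\<^sub>R d \<in> S \<and> x + t *\<^sub>R d \<noteq> x"
      using seg \<open>0 < T\<close> by (intro eventually_at_rightI[of 0 T]) force+
    show "((\<lambda>t. x + t *\<^sub>R d) \<longlongrightarrow> x) (at_right 0)"
      by (auto intro!: tendsto_eq_intros)
  qed
  then have "((\<lambda>t. G (x + t *\<^sub>R d) \<bullet> d) \<longlongrightarrow> p \<bullet> d) (at_right 0)"
    using filterlim_compose[OF assms(2)] by (intro tendsto_inner tendsto_const) blast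
  then have "\<forall>\<^sub>F t in at_right 0. G (x + t *\<^sub>R d) \<bullet> d < \<kappa>"
    using \<open>\<not> \<kappa> \<le> p \<bullet> d\<close> by (intro order_tendstoD(2)) auto
  then obtain b where b: "b > 0" "\<And>t. 0 < t \<Longrightarrow> t < b \<Longrightarrow> G (x + t *\<^sub>R d) \<bullet> d < \<kappa>"
    unfolding eventually_at_right_field by auto
  define t where "t = min b T / 2"
  have t: "0 < t" "t < b" "t < T" using b \<open>T > 0\<close> by (auto simp: t_def)
  have "\<exists>l z. 0 < z \<and> z < t \<and> DERIV (\<lambda>t. w (x + t *\<^sub>R d)) z :> l \<and> 
      w (x + t *\<^sub>R d) - w (x + 0 *\<^sub>R d) = (t - 0) * l"
  proof (rule MVT[OF t(1)])
    have "(\<lambda>t. x + t *\<^sub>R d) ` {0..t} \<subseteq> D"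
    proof safe
      fix s assume "s \<in> {0..t}"
      then show "x + s *\<^sub>R d \<in> D"
        using seg[of s] t assms(6,7) by (cases "s = 0") auto
    qed
    then show "continuous_on {0..t} (\<lambda>t. w (x + t *\<^sub>R d))"
      by (intro continuous_on_compose2[OF assms(1)] continuous_intros)
    show "(\<lambda>t. w (x + t *\<^sub>R d)) differentiable at s" if "0 < s" "s < t" for s
      using has_derivative_along_line[OF der[of "x + s *\<^sub>R d"]] seg[of s] that t
        real_differentiable_def by fastforce
  qed
  then obtain l z where z: "0 < z" "z < t" "DERIV (\<lambda>t. w (x + t *\<^sub>R d)) z :> l"
    "w (x + t *\<^sub>R d) - w x = t * l" by auto
  have "l = G (x + z *\<^sub>R d) \<bullet> d"
    using z t seg[of z] by (intro DERIV_unique[OF z(3)] has_derivative_along_line der) auto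
  then have "l < \<kappa>" using b(2)[of z] z t by auto
  then have "t * l < \<kappa> * t" using t by (simp add: mult.commute)
  then have "w (x + t *\<^sub>R d) < w x + \<kappa> * t" using z by linarith
  then show False using growth[of t] t by auto
qed

lemma has_grad_hess_subset: "has_grad_hess D w G H \<Longrightarrow> U \<subseteq> D \<Longrightarrow> has_grad_hess U w G H"
  by (auto simp: has_grad_hess_def)

lemma has_grad_hess_diff:
  assumes "has_grad_hess D w G H" "has_grad_hess D w' G' H'"
  shows "has_grad_hess D (\<lambda>x. w x - w' x) (\<lambda>x. G x - G' x) (\<lambda>x. H x - H' x)"
  unfolding has_grad_hess_def
proof (intro ballI conjI)
  fix x assume "x \<in> D"
  then have "(w has_derivative (\<lambda>v. G x \<bullet> v)) (at x)" "(w' has_derivative (\<lambda>v. G' x \<bullet> v)) (at x)"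
    "(G has_derivative (\<lambda>v. H x *v v)) (at x)" "(G' has_derivative (\<lambda>v. H' x *v v)) (at x)"
    using assms by (auto simp: has_grad_hess_def)
  then show "((\<lambda>x. w x - w' x) has_derivative (\<lambda>v. (G x - G' x) \<bullet> v)) (at x)"
    "((\<lambda>x. G x - G' x) has_derivative (\<lambda>v. (H x - H' x) *v v)) (at x)"
    unfolding inner_diff_left matrix_vector_mult_diff_rdistrib by - (rule has_derivative_diff; assumption)+
qed

lemma has_grad_hess_affine:
  assumes "has_grad_hess D w G H"
  shows "has_grad_hess D (\<lambda>x. s * w x + k) (\<lambda>x. s *\<^sub>R G x) (\<lambda>x. s *\<^sub>R H x)"
  unfolding has_grad_hess_def
proof (intro ballI conjI)
  fix x assume "x \<in> D"
  then have "(w has_derivative (\<lambda>v. G x \<bullet> v)) (at x)" "(G has_derivative (\<lambda>v. H x *v v)) (at x)"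
    using assms by (auto simp: has_grad_hess_def)
  then show "((\<lambda>x. s * w x + k) has_derivative (\<lambda>v. (s *\<^sub>R G x) \<bullet> v)) (at x)"
    "((\<lambda>x. s *\<^sub>R G x) has_derivative (\<lambda>v. (s *\<^sub>R H x) *v v)) (at x)"
    unfolding scaleR_matrix_vector_assoc[symmetric]
    by (auto intro!: derivative_eq_intros)
qed

lemma has_grad_hess_imp_continuous_on:
  assumes "has_grad_hess D w G H"
  shows "continuous_on D w" "continuous_on D G"
  using assms unfolding has_grad_hess_def
  by (meson has_derivative_at_withinI has_derivative_continuous_on)+

lemma Lim_partial_eq_gradient:
  assumes "open D" "continuous_on (closure D) G" "has_grad_hess D u G H" "x \<in> frontier D"
  shows "Lim (at x within D) (partial j u) = G x $ j"
proof (rule tendsto_Lim)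
  have x: "x \<in> closure D" "x \<notin> D" using assms(1,4) by (auto simp: frontier_def interior_open)
  then show "\<not> trivial_limit (at x within D)"
    by (auto simp: trivial_limit_within closure_def)
  have "partial j u y = G y $ j" if "y \<in> D" for y
  proof -
    have "(u has_derivative (\<lambda>v. G y \<bullet> v)) (at y)" using assms(3) that by (simp add: has_grad_hess_def)
    then have "((\<lambda>t. u (y + t *\<^sub>R axis j 1)) has_real_derivative G y \<bullet> axis j 1) (at 0)"
      by (intro has_derivative_along_line) simp
    then show ?thesis by (simp add: partial_def DERIV_imp_deriv inner_axis)
  qed
  then have "\<forall>\<^sub>F y in at x within D. partial j u y = G y $ j"
    by (simp add: eventually_at_filter)
  moreover have "(G \<longlongrightarrow> G x) (at x within D)"
    using assms(2) x(1) closure_subset unfolding continuous_on_def by (blast intro: tendsto_within_subset)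
  then have "((\<lambda>y. G y $ j) \<longlongrightarrow> G x $ j) (at x within D)" by (rule tendsto_vec_nth)
  ultimately show "(partial j u \<longlongrightarrow> G x $ j) (at x within D)" by (simp add: tendsto_cong)
qed

section \<open>Nonnegativity of the trace of a product of positive semidefinite matrices\<close>

text \<open>Symmetric Gaussian elimination. If \<open>\<kappa> = A\<^sub>k\<^sub>k > 0\<close> and \<open>v\<close> is the \<open>k\<close>-th column of \<open>A\<close>, then
  \<open>A = A' + v v\<^sup>T / \<kappa>\<close>, where \<open>A'\<close> is again positive semidefinite and its \<open>k\<close>-th row and column vanish; the
  rank-one part contributes \<open>v \<bullet> M v / \<kappa> \<ge> 0\<close>. If \<open>A\<^sub>k\<^sub>k = 0\<close>, semidefiniteness forces the \<open>k\<close>-th row to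
  vanish already. The induction is on the set \<open>S\<close> of indices of nonzero rows.\<close>

lemma psd_trace_nonneg:
  fixes A M :: "real^'n::finite^'n"
  assumes "\<And>i j. A $ i $ j = A $ j $ i" "\<And>\<xi>. 0 \<le> \<xi> \<bullet> (A *v \<xi>)" "\<And>\<xi>. 0 \<le> \<xi> \<bullet> (M *v \<xi>)"
  shows "0 \<le> (\<Sum>i\<in>UNIV. \<Sum>j\<in>UNIV. A $ i $ j * M $ i $ j)"
proof -
  have "0 \<le> (\<Sum>i\<in>UNIV. \<Sum>j\<in>UNIV. A $ i $ j * M $ i $ j)"
    if "finite S" "\<And>i j. A $ i $ j = A $ j $ i" "\<And>\<xi>. 0 \<le> \<xi> \<bullet> (A *v \<xi>)"
      "\<And>i j. A $ i $ j \<noteq> 0 \<Longrightarrow> i \<in> S \<and> j \<in> S" for S and A :: "real^'n^'n"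
    using that
  proof (induction S arbitrary: A)
    case empty
    then have "A $ i $ j = 0" for i j by blast
    then show ?case by simp
  next
    case (insert k S)
    have Ae: "A *v axis j 1 = column j A" for j by (rule matrix_vector_mult_basis)
    have Akk: "axis i 1 \<bullet> (A *v axis j 1) = A $ i $ j" for i j
      unfolding Ae by (simp add: inner_axis' column_def)
    have self: "\<eta> \<bullet> (A *v \<xi>) = \<xi> \<bullet> (A *v \<eta>)" for \<xi> \<eta>
    proof -
      have "transpose A = A" using insert.prems(1) by (simp add: transpose_def vec_eq_iff)
      then show ?thesis by (metis dot_lmul_matrix inner_commute transpose_matrix_vector)
    qed
    show ?case
    proof (cases "A $ k $ k = 0")
      case True
      have row0: "A $ k $ j = 0" for j
      proof (rule ccontr)
        assume nz: "A $ k $ j \<noteq> 0"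
        \<comment> \<open>chosen so that the quadratic form has the value \<open>-1\<close> at \<open>e\<^sub>j + t e\<^sub>k\<close>\<close>
        define t where "t = - (A $ j $ j + 1) / (2 * A $ k $ j)"
        have "(axis j 1 + t *\<^sub>R axis k 1) \<bullet> (A *v (axis j 1 + t *\<^sub>R axis k 1)) =
            A $ j $ j + t * A $ j $ k + t * A $ k $ j + t * t * A $ k $ k"
          unfolding matrix_vector_right_distrib matrix_vector_mult_scaleR inner_add_left inner_add_right
            inner_scaleR_left inner_scaleR_right Akk by (simp add: algebra_simps)
        also have "\<dots> = A $ j $ j + 2 * t * A $ k $ j"
          using True insert.prems(1)[of j k] by simp
        also have "\<dots> = -1" using nz by (simp add: t_def field_simps)
        finally show False using insert.prems(2)[of "axis j 1 + t *\<^sub>R axis k 1"] by linarith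
      qed
      then have "A $ j $ k = 0" for j using insert.prems(1) by metis
      then have "i \<in> S \<and> j \<in> S" if "A $ i $ j \<noteq> 0" for i j
        using row0 insert.prems(3)[of i j] that by auto
      then show ?thesis by (rule insert.IH[OF insert.prems(1,2)])
    next
      case False
      define \<kappa> where "\<kappa> = A $ k $ k"
      have "0 \<le> \<kappa>" using insert.prems(2)[of "axis k 1"] unfolding Akk \<kappa>_def .
      then have "\<kappa> > 0" using False by (simp add: \<kappa>_def)
      define v where "v = column k A"
      have v: "v $ i = A $ i $ k" for i by (simp add: v_def column_def)
      define A' where "A' = (\<chi> i j. A $ i $ j - v $ i * v $ j / \<kappa>)"
      have A'v: "A' *v \<xi> = A *v \<xi> - ((v \<bullet> \<xi>) / \<kappa>) *\<^sub>R v" for \<xi>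
        by (simp add: vec_eq_iff matrix_vector_mult_def A'_def inner_vec_def left_diff_distrib
            right_diff_distrib sum_subtractf sum_distrib_left sum_divide_distrib mult_ac)
      have "0 \<le> (\<Sum>i\<in>UNIV. \<Sum>j\<in>UNIV. A' $ i $ j * M $ i $ j)"
      proof (rule insert.IH)
        show "A' $ i $ j = A' $ j $ i" for i j
          using insert.prems(1)[of i j] by (simp add: A'_def mult.commute)
        show "0 \<le> \<xi> \<bullet> (A' *v \<xi>)" for \<xi>
        proof -
          \<comment> \<open>completing the square: subtracting \<open>s e\<^sub>k\<close> from \<open>\<xi>\<close> minimises the form of \<open>A\<close>, and the
            minimum is the form of \<open>A'\<close> at \<open>\<xi>\<close>\<close>
          define s where "s = (v \<bullet> \<xi>) / \<kappa>"
          have ek: "\<xi> \<bullet> (A *v axis k 1) = v \<bullet> \<xi>" by (simp add: Ae v_def inner_commute)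
          have "(\<xi> - s *\<^sub>R axis k 1) \<bullet> (A *v (\<xi> - s *\<^sub>R axis k 1)) =
             \<xi> \<bullet> (A *v \<xi>) - 2 * s * (v \<bullet> \<xi>) + s * s * \<kappa>"
            unfolding matrix_vector_mult_diff_distrib matrix_vector_mult_scaleR inner_diff_left inner_diff_right
              inner_scaleR_left inner_scaleR_right self[of "axis k 1" \<xi>] ek Akk \<kappa>_def
            by (simp add: algebra_simps)
          also have "\<dots> = \<xi> \<bullet> (A' *v \<xi>)"
            using \<open>\<kappa> > 0\<close> by (simp add: A'v s_def inner_diff_right inner_commute field_simps)
          finally show ?thesis using insert.prems(2)[of "\<xi> - s *\<^sub>R axis k 1"] by simp
        qed
        have "A' $ i $ k = 0" "A' $ k $ i = 0" for i
          using \<open>\<kappa> > 0\<close> insert.prems(1)[of k i] by (simp_all add: A'_def v \<kappa>_def)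
        show "i \<in> S \<and> j \<in> S" if "A' $ i $ j \<noteq> 0" for i j
        proof -
          have "A $ i $ j \<noteq> 0 \<or> A $ i $ k \<noteq> 0" "A $ i $ j \<noteq> 0 \<or> A $ j $ k \<noteq> 0"
            using that by (auto simp: A'_def v)
          then have "i \<in> insert k S" "j \<in> insert k S"
            using insert.prems(3) by blast+
          moreover have "i \<noteq> k" "j \<noteq> k" using that \<open>\<And>i. A' $ i $ k = 0\<close> \<open>\<And>i. A' $ k $ i = 0\<close> by auto
          ultimately show ?thesis by blast
        qed
      qed
      moreover have "0 \<le> (v \<bullet> (M *v v)) / \<kappa>"
        using assms(3) \<open>\<kappa> > 0\<close> by simp
      moreover have "(\<Sum>i\<in>UNIV. \<Sum>j\<in>UNIV. A $ i $ j * M $ i $ j) =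
         (\<Sum>i\<in>UNIV. \<Sum>j\<in>UNIV. A' $ i $ j * M $ i $ j) + (v \<bullet> (M *v v)) / \<kappa>"
      proof -
        have "v \<bullet> (M *v v) / \<kappa> = (\<Sum>i\<in>UNIV. \<Sum>j\<in>UNIV. v $ i * v $ j / \<kappa> * M $ i $ j)"
          by (simp add: inner_vec_def matrix_vector_mult_def sum_distrib_left sum_divide_distrib mult_ac)
        then show ?thesis
          by (simp add: A'_def left_diff_distrib sum_subtractf)
      qed
      ultimately show ?thesis by simp
    qed
  qed
  from this[of UNIV A, OF _ assms(1,2)] show ?thesis by simp
qed

section \<open>Gaussian barrier\<close>

text \<open>The barrier \<open>exp (- \<gamma> |x - y|\<^sup>2)\<close> serves both the weak minimum principle, with \<open>y\<close> far from the
  domain, and Hopf's lemma, with \<open>y\<close> the centre of an interior ball.\<close>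

definition gauss_bump :: "real \<Rightarrow> real^'n::finite \<Rightarrow> real^'n \<Rightarrow> real" where
  "gauss_bump \<gamma> y x = exp (- \<gamma> * ((x - y) \<bullet> (x - y)))"

definition gauss_grad :: "real \<Rightarrow> real^'n::finite \<Rightarrow> real^'n \<Rightarrow> real^'n" where
  "gauss_grad \<gamma> y x = (- 2 * \<gamma> * gauss_bump \<gamma> y x) *\<^sub>R (x - y)"

definition gauss_hess :: "real \<Rightarrow> real^'n::finite \<Rightarrow> real^'n \<Rightarrow> real^'n^'n" where
  "gauss_hess \<gamma> y x = (\<chi> i j. gauss_bump \<gamma> y x *
     (4 * \<gamma>\<^sup>2 * (x - y) $ i * (x - y) $ j - (if i = j then 2 * \<gamma> else 0)))"

lemma gauss_bump_grad_hess:
  fixes y :: "real^'n::finite"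
  shows "has_grad_hess D (gauss_bump \<gamma> y) (gauss_grad \<gamma> y) (gauss_hess \<gamma> y)"
  unfolding has_grad_hess_def
proof (intro ballI conjI)
  fix x :: "real^'n"
  show w: "(gauss_bump \<gamma> y has_derivative (\<lambda>v. gauss_grad \<gamma> y x \<bullet> v)) (at x)"
    unfolding gauss_bump_def gauss_grad_def
    by (auto intro!: derivative_eq_intros simp: inner_commute algebra_simps)
  have mult: "gauss_hess \<gamma> y x *v v =
      gauss_bump \<gamma> y x *\<^sub>R ((4 * \<gamma>\<^sup>2 * ((x - y) \<bullet> v)) *\<^sub>R (x - y) - (2 * \<gamma>) *\<^sub>R v)" for v
  proof -
    have "(\<Sum>j\<in>UNIV. (gauss_bump \<gamma> y x * (4 * \<gamma>\<^sup>2 * (x - y) $ i * (x - y) $ j - (if i = j then 2 * \<gamma> else 0))) * v $ j)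
       = (\<Sum>j\<in>UNIV. gauss_bump \<gamma> y x * 4 * \<gamma>\<^sup>2 * (x - y) $ i * ((x - y) $ j * v $ j) -
            (if i = j then gauss_bump \<gamma> y x * 2 * \<gamma> * v $ j else 0))" for i
      by (intro sum.cong) (auto simp: algebra_simps)
    also have "\<dots> i = gauss_bump \<gamma> y x * 4 * \<gamma>\<^sup>2 * (x - y) $ i * ((x - y) \<bullet> v)
         - gauss_bump \<gamma> y x * 2 * \<gamma> * v $ i" for i
      unfolding sum_subtractf sum_distrib_left[symmetric] by (simp add: inner_vec_def)
    finally show ?thesis
      by (simp add: vec_eq_iff matrix_vector_mult_def gauss_hess_def algebra_simps)
  qed
  have "((\<lambda>x. (- 2 * \<gamma> * gauss_bump \<gamma> y x) *\<^sub>R (x - y)) has_derivative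
       (\<lambda>v. gauss_hess \<gamma> y x *v v)) (at x)"
    by (rule derivative_eq_intros w refl)+
       (simp add: mult gauss_grad_def fun_eq_iff algebra_simps power2_eq_square)
  then show "(gauss_grad \<gamma> y has_derivative (\<lambda>v. gauss_hess \<gamma> y x *v v)) (at x)"
    by (simp add: gauss_grad_def[abs_def])
qed

lemma gauss_bump_pos: "0 < gauss_bump \<gamma> y x"
  by (simp add: gauss_bump_def)

lemma gauss_bump_le_1: "0 \<le> \<gamma> \<Longrightarrow> gauss_bump \<gamma> y x \<le> 1"
  by (simp add: gauss_bump_def)

lemma continuous_on_gauss_bump: "continuous_on S (gauss_bump \<gamma> y)"
  unfolding gauss_bump_def by (intro continuous_intros)

section \<open>Minimum principles and Hopf's lemma\<close>

text \<open>The size of \<open>A\<close> enters through its trace: the Hessian of a radial barrier contains a negative multiple of the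
  identity, on which the second order part of the operator is the trace.\<close>

locale elliptic_operator =
  fixes D :: "(real^'n::finite) set" and A :: "real^'n \<Rightarrow> real^'n^'n" and b :: "real^'n \<Rightarrow> real^'n"
    and c B :: real
  assumes open_D: "open D"
    and A_sym: "x \<in> D \<Longrightarrow> A x $ i $ j = A x $ j $ i"
    and c_pos: "0 < c"
    and A_elliptic: "x \<in> D \<Longrightarrow> c * (norm \<xi>)\<^sup>2 \<le> \<xi> \<bullet> (A x *v \<xi>)"
    and trace_bound: "x \<in> D \<Longrightarrow> trace (A x) \<le> B"
    and b_bound: "x \<in> D \<Longrightarrow> norm (b x) \<le> B"
begin

text \<open>The arguments are the values of a gradient and a Hessian at \<open>x\<close>, so that linearity is a statement about vectors and
  matrices and not about differentiation.\<close>

definition L :: "real^'n \<Rightarrow> real^'n \<Rightarrow> real^'n^'n \<Rightarrow> real" where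
  "L x p M = (\<Sum>i\<in>UNIV. \<Sum>j\<in>UNIV. A x $ i $ j * M $ i $ j) + b x \<bullet> p"

lemma L_diff: "L x (p - q) (M - N) = L x p M - L x q N"
  by (simp add: L_def inner_diff_right right_diff_distrib sum_subtractf)

lemma L_scale: "L x (s *\<^sub>R p) (s *\<^sub>R M) = s * L x p M"
  by (simp add: L_def sum_distrib_left algebra_simps)

lemma L_nonneg_at_min:
  assumes "open U" "U \<subseteq> D" "has_grad_hess U w G H" "x \<in> U" "\<And>y. y \<in> U \<Longrightarrow> w x \<le> w y"
  shows "0 \<le> L x (G x) (H x)"
proof -
  have "x \<in> D" using assms by auto
  have "0 \<le> (\<Sum>i\<in>UNIV. \<Sum>j\<in>UNIV. A x $ i $ j * H x $ i $ j)"
  proof (rule psd_trace_nonneg)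
    show "0 \<le> \<xi> \<bullet> (A x *v \<xi>)" for \<xi>
      using A_elliptic[OF \<open>x \<in> D\<close>, of \<xi>] c_pos by (meson less_imp_le mult_nonneg_nonneg order_trans zero_le_power2)
    show "A x $ i $ j = A x $ j $ i" for i j by (rule A_sym[OF \<open>x \<in> D\<close>])
    show "0 \<le> \<xi> \<bullet> (H x *v \<xi>)" for \<xi> by (rule interior_min_grad_hess(2)[OF assms(1,4,3,5)])
  qed
  moreover have "G x = 0" by (rule interior_min_grad_hess(1)[OF assms(1,4,3,5)])
  ultimately show ?thesis by (simp add: L_def)
qed

text \<open>The strict inequality is required only where \<open>w\<close> is negative. This lets the lower order term \<open>Q w\<close> be
  absorbed in the applications.\<close>

lemma strict_minimum_principle:
  assumes "open U" "bounded U" "U \<subseteq> D" "continuous_on (closure U) w" "has_grad_hess U w G H"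
    and neg: "\<And>x. x \<in> U \<Longrightarrow> w x < 0 \<Longrightarrow> L x (G x) (H x) < 0"
    and bd: "\<And>x. x \<in> closure U - U \<Longrightarrow> 0 \<le> w x"
    and "x \<in> closure U"
  shows "0 \<le> w x"
proof (rule ccontr)
  assume "\<not> 0 \<le> w x"
  obtain m where m: "m \<in> closure U" "\<And>y. y \<in> closure U \<Longrightarrow> w m \<le> w y"
    using continuous_attains_inf[of "closure U" w] assms by (metis compact_closure empty_iff)
  then have "w m < 0" using \<open>\<not> 0 \<le> w x\<close> assms(8) by fastforce
  then have "m \<in> U" using bd[of m] m by force
  have "0 \<le> L m (G m) (H m)"
    using closure_subset m by (intro L_nonneg_at_min[OF assms(1,3,5) \<open>m \<in> U\<close>]) blast
  then show False using neg[OF \<open>m \<in> U\<close> \<open>w m < 0\<close>] by simp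
qed

text \<open>With \<open>h\<close> the barrier and \<open>d = x - y\<close>,
  \<open>L h = h (4 \<gamma>\<^sup>2 (d \<bullet> A d) - 2 \<gamma> (trace A + b \<bullet> d))\<close>. Away from \<open>y\<close> the quadratic term in \<open>\<gamma>\<close> is at
  least \<open>4 \<gamma>\<^sup>2 c \<rho>\<^sup>2\<close>, so it dominates for large \<open>\<gamma>\<close>.\<close>

lemma gauss_bump_strict_subsolution:
  assumes "0 < \<rho>"
  obtains \<gamma> where "0 < \<gamma>"
    "\<And>x. x \<in> D \<Longrightarrow> \<rho> \<le> dist x y \<Longrightarrow> dist x y \<le> M \<Longrightarrow>
       Q * gauss_bump \<gamma> y x < L x (gauss_grad \<gamma> y x) (gauss_hess \<gamma> y x)"
proof -
  define K where "K = \<bar>B\<bar> + \<bar>B\<bar> * \<bar>M\<bar>"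
  \<comment> \<open>so that \<open>\<gamma> \<ge> 1\<close> and \<open>4 c \<rho>\<^sup>2 \<gamma> > 2 K + |Q|\<close>\<close>
  \<comment> \<open>large enough that \<open>\<gamma> \<ge> 1\<close> and \<open>4 c \<rho>\<^sup>2 \<gamma> > 2 K + |Q|\<close>\<close>
  define \<gamma> where "\<gamma> = 1 + (2 * K + \<bar>Q\<bar>) / (4 * c * \<rho>\<^sup>2)"
  have "K \<ge> 0" by (simp add: K_def)
  have pos: "0 < 4 * c * \<rho>\<^sup>2" using c_pos assms by simp
  have "1 \<le> \<gamma>" unfolding \<gamma>_def using pos \<open>K \<ge> 0\<close> by simp
  have "E * (1 + X / E) = E + X" if "0 < E" for E X :: real
    using that by (simp add: distrib_left)
  from this[OF pos, of "2 * K + \<bar>Q\<bar>"]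
  have "4 * c * \<rho>\<^sup>2 * \<gamma> = 4 * c * \<rho>\<^sup>2 + (2 * K + \<bar>Q\<bar>)"
    unfolding \<gamma>_def .
  then have "2 * K + \<bar>Q\<bar> < 4 * c * \<rho>\<^sup>2 * \<gamma>" using pos by simp
  then have "\<gamma> * (2 * K + \<bar>Q\<bar>) < \<gamma> * (4 * c * \<rho>\<^sup>2 * \<gamma>)" using \<open>1 \<le> \<gamma>\<close> by simp
  moreover have "\<bar>Q\<bar> \<le> \<gamma> * \<bar>Q\<bar>" using \<open>1 \<le> \<gamma>\<close> by (simp add: mult_le_cancel_right1)
  ultimately have \<gamma>: "Q < 4 * \<gamma>\<^sup>2 * (c * \<rho>\<^sup>2) - 2 * \<gamma> * K"
    by (simp add: algebra_simps power2_eq_square)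
  have "Q * gauss_bump \<gamma> y x < L x (gauss_grad \<gamma> y x) (gauss_hess \<gamma> y x)"
    if x: "x \<in> D" "\<rho> \<le> dist x y" "dist x y \<le> M" for x
  proof -
    define d where "d = x - y"
    have "c * \<rho>\<^sup>2 \<le> c * (norm d)\<^sup>2"
      using x assms c_pos by (intro mult_left_mono power_mono) (auto simp: d_def dist_norm)
    then have dAd: "c * \<rho>\<^sup>2 \<le> d \<bullet> (A x *v d)" using A_elliptic[OF x(1), of d] by simp
    have "b x \<bullet> d \<le> norm (b x) * norm d" by (rule norm_cauchy_schwarz)
    also have "\<dots> \<le> \<bar>B\<bar> * \<bar>M\<bar>"
      using b_bound[OF x(1)] x by (intro mult_mono) (auto simp: d_def dist_norm)
    finally have K: "trace (A x) + b x \<bullet> d \<le> K" using trace_bound[OF x(1)] by (simp add: K_def)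
    have "(\<Sum>j\<in>UNIV. A x $ i $ j * gauss_hess \<gamma> y x $ i $ j) =
        (\<Sum>j\<in>UNIV. 4 * \<gamma>\<^sup>2 * gauss_bump \<gamma> y x * (d $ i * (A x $ i $ j * d $ j)) -
            (if i = j then gauss_bump \<gamma> y x * 2 * \<gamma> * A x $ i $ j else 0))" for i
      by (intro sum.cong) (auto simp: gauss_hess_def d_def algebra_simps)
    also have "\<dots> i = 4 * \<gamma>\<^sup>2 * gauss_bump \<gamma> y x * (d $ i * (A x *v d) $ i)
          - gauss_bump \<gamma> y x * 2 * \<gamma> * A x $ i $ i" for i
      unfolding sum_subtractf sum_distrib_left[symmetric] by (simp add: matrix_vector_mult_def)
    finally have "(\<Sum>i\<in>UNIV. \<Sum>j\<in>UNIV. A x $ i $ j * gauss_hess \<gamma> y x $ i $ j) =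
        4 * \<gamma>\<^sup>2 * gauss_bump \<gamma> y x * (d \<bullet> (A x *v d)) - gauss_bump \<gamma> y x * 2 * \<gamma> * trace (A x)"
      by (simp add: sum_subtractf inner_vec_def trace_def flip: sum_distrib_left)
    then have "L x (gauss_grad \<gamma> y x) (gauss_hess \<gamma> y x) =
        gauss_bump \<gamma> y x * (4 * \<gamma>\<^sup>2 * (d \<bullet> (A x *v d)) - 2 * \<gamma> * (trace (A x) + b x \<bullet> d))"
      by (simp add: L_def gauss_grad_def d_def[symmetric] algebra_simps)
    moreover have "4 * \<gamma>\<^sup>2 * (c * \<rho>\<^sup>2) \<le> 4 * \<gamma>\<^sup>2 * (d \<bullet> (A x *v d))"
      using dAd by (intro mult_left_mono) auto
    moreover have "2 * \<gamma> * (trace (A x) + b x \<bullet> d) \<le> 2 * \<gamma> * K"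
      using K \<open>1 \<le> \<gamma>\<close> by (intro mult_left_mono) auto
    ultimately show ?thesis using \<gamma> gauss_bump_pos[of \<gamma> y x]
      by (simp add: mult.commute[of Q])
  qed
  then show ?thesis using that[of \<gamma>] \<open>1 \<le> \<gamma>\<close> by simp
qed

text \<open>Subtracting a small multiple of the barrier makes the differential inequality strict. The constant \<open>\<epsilon>\<close> is added
  back so that the boundary values stay nonnegative.\<close>

lemma weak_minimum_principle:
  assumes "bounded D" "continuous_on (closure D) w" "has_grad_hess D w G H"
    and super: "\<And>x. x \<in> D \<Longrightarrow> w x < 0 \<Longrightarrow> L x (G x) (H x) \<le> 0"
    and bd: "\<And>x. x \<in> frontier D \<Longrightarrow> 0 \<le> w x"
    and "x \<in> closure D"
  shows "0 \<le> w x"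
proof (rule ccontr)
  assume "\<not> 0 \<le> w x"
  define \<epsilon> where "\<epsilon> = - w x / 2"
  have "\<epsilon> > 0" using \<open>\<not> 0 \<le> w x\<close> by (simp add: \<epsilon>_def)
  obtain N where N: "N > 0" "\<And>z. z \<in> D \<Longrightarrow> norm z \<le> N"
    using assms(1) unfolding bounded_pos by blast
  \<comment> \<open>a centre at distance at least \<open>1\<close> from the domain\<close>
  define y :: "real^'n" where "y = (N + 1) *\<^sub>R axis undefined 1"
  have ny: "norm y = N + 1" using N by (simp add: y_def)
  have y: "1 \<le> dist z y" "dist z y \<le> 2 * N + 1" if "z \<in> D" for z
    using N(2)[OF that] ny norm_triangle_ineq4[of z y] norm_triangle_ineq2[of y z]
    by (auto simp: dist_norm norm_minus_commute)
  obtain \<gamma> where \<gamma>: "0 < \<gamma>" "\<And>x. x \<in> D \<Longrightarrow> 1 \<le> dist x y \<Longrightarrow> dist x y \<le> 2 * N + 1 \<Longrightarrow>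
       0 * gauss_bump \<gamma> y x < L x (gauss_grad \<gamma> y x) (gauss_hess \<gamma> y x)"
    using gauss_bump_strict_subsolution[of 1 y "2 * N + 1" 0] by (metis zero_less_one)
  let ?h = "gauss_bump \<gamma> y"
  have h1: "?h z \<le> 1" for z using \<gamma> by (intro gauss_bump_le_1) auto
  have "0 \<le> w x - (\<epsilon> * ?h x + (- \<epsilon>))"
  proof (rule strict_minimum_principle[where U = D])
    show "continuous_on (closure D) (\<lambda>x. w x - (\<epsilon> * ?h x + (- \<epsilon>)))"
      by (intro continuous_intros assms continuous_on_gauss_bump)
    show "has_grad_hess D (\<lambda>x. w x - (\<epsilon> * ?h x + (- \<epsilon>)))
        (\<lambda>x. G x - \<epsilon> *\<^sub>R gauss_grad \<gamma> y x) (\<lambda>x. H x - \<epsilon> *\<^sub>R gauss_hess \<gamma> y x)"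
      by (intro has_grad_hess_diff has_grad_hess_affine assms gauss_bump_grad_hess)
    have hle: "\<epsilon> * ?h z \<le> \<epsilon>" for z using h1[of z] \<open>\<epsilon> > 0\<close> by simp
    show "L z (G z - \<epsilon> *\<^sub>R gauss_grad \<gamma> y z) (H z - \<epsilon> *\<^sub>R gauss_hess \<gamma> y z) < 0"
      if "z \<in> D" "w z - (\<epsilon> * ?h z + (- \<epsilon>)) < 0" for z
    proof -
      have "L z (G z) (H z) \<le> 0" using super that hle[of z] by simp
      moreover have "0 < \<epsilon> * L z (gauss_grad \<gamma> y z) (gauss_hess \<gamma> y z)"
        using \<gamma>(2)[OF that(1) y[OF that(1)]] \<open>\<epsilon> > 0\<close> by simp
      ultimately show ?thesis by (simp add: L_diff L_scale)
    qed
    show "0 \<le> w z - (\<epsilon> * ?h z + (- \<epsilon>))" if "z \<in> closure D - D" for z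
      using bd[of z] that hle[of z] open_D by (simp add: frontier_def interior_open)
  qed (use assms open_D in auto)
  moreover have "0 < \<epsilon> * ?h x" using gauss_bump_pos[of \<gamma> y x] \<open>\<epsilon> > 0\<close> by simp
  ultimately show False using \<open>\<not> 0 \<le> w x\<close> by (simp add: \<epsilon>_def)
qed

text \<open>In the annulus between radii \<open>r / 2\<close> and \<open>r\<close>, \<open>w\<close> lies above a small multiple of
  \<open>h - e0\<close>, where \<open>h\<close> is the barrier centred at \<open>y\<close> and \<open>e0\<close> is its value on the outer sphere. On that
  sphere \<open>h - e0\<close> vanishes, and it grows linearly inwards. On the inner sphere \<open>w\<close> has a positive minimum.
  Where \<open>w < \<epsilon> (h - e0)\<close> one has \<open>Q w \<le> \<epsilon> Q h < \<epsilon> L h\<close>, so \<open>w - \<epsilon> (h - e0)\<close> falls under the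
  strict minimum principle.\<close>

lemma hopf_linear_growth:
  assumes "0 < r" "ball y r \<subseteq> D" "continuous_on (cball y r) w" "has_grad_hess D w G H"
    and super: "\<And>x. x \<in> ball y r \<Longrightarrow> L x (G x) (H x) \<le> Q * w x"
    and pos: "\<And>x. x \<in> ball y r \<Longrightarrow> 0 < w x" and nonneg: "\<And>x. x \<in> sphere y r \<Longrightarrow> 0 \<le> w x"
    and "0 \<le> Q"
  obtains \<kappa> where "0 < \<kappa>" "\<And>z t. z \<in> sphere y r \<Longrightarrow> 0 < t \<Longrightarrow> t < 1/2 \<Longrightarrow> \<kappa> * t \<le> w (z + t *\<^sub>R (y - z))"
proof -
  obtain \<gamma> where \<gamma>: "0 < \<gamma>" "\<And>x. x \<in> D \<Longrightarrow> r / 2 \<le> dist x y \<Longrightarrow> dist x y \<le> r \<Longrightarrow>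
       Q * gauss_bump \<gamma> y x < L x (gauss_grad \<gamma> y x) (gauss_hess \<gamma> y x)"
    using gauss_bump_strict_subsolution[of "r/2" y r Q] \<open>0 < r\<close> by (metis half_gt_zero)
  let ?h = "gauss_bump \<gamma> y"
  have sph: "sphere y (r/2) \<subseteq> ball y r" using \<open>0 < r\<close> by (auto simp: )
  have "\<exists>\<epsilon>>0. \<forall>x\<in>sphere y (r/2). \<epsilon> \<le> w x"
  proof (cases "sphere y (r/2) = {}")
    case True
    then show ?thesis by (intro exI[of _ 1]) auto
  next
    case False
    have "continuous_on (sphere y (r/2)) w"
      using assms(3) sph by (meson ball_subset_cball continuous_on_subset order_trans)
    then obtain m where "m \<in> sphere y (r/2)" "\<And>x. x \<in> sphere y (r/2) \<Longrightarrow> w m \<le> w x"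
      using continuous_attains_inf[OF compact_sphere False] by blast
    then show ?thesis using pos sph by blast
  qed
  then obtain \<epsilon> where \<epsilon>: "\<epsilon> > 0" "\<And>x. x \<in> sphere y (r/2) \<Longrightarrow> \<epsilon> \<le> w x" by blast
  define e0 where "e0 = exp (- \<gamma> * r\<^sup>2)"
  have "e0 > 0" by (simp add: e0_def)
  define U where "U = ball y r - cball y (r/2)"
  have Usub: "U \<subseteq> ball y r" by (auto simp: U_def)
  have clU: "closure U \<subseteq> cball y r - ball y (r/2)"
    by (rule closure_minimal) (auto simp: U_def)
  have on_U: "0 \<le> w x - (\<epsilon> * ?h x + (- (\<epsilon> * e0)))" if "x \<in> closure U" for x
  proof (rule strict_minimum_principle[where U = U])
    show "open U" "bounded U" "U \<subseteq> D" using assms(2) Usub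
      by (auto simp: U_def intro: bounded_subset[OF bounded_ball])
    show "continuous_on (closure U) (\<lambda>x. w x - (\<epsilon> * ?h x + (- (\<epsilon> * e0))))"
      using clU by (intro continuous_intros continuous_on_gauss_bump continuous_on_subset[OF assms(3)]) blast
    show "has_grad_hess U (\<lambda>x. w x - (\<epsilon> * ?h x + (- (\<epsilon> * e0))))
        (\<lambda>x. G x - \<epsilon> *\<^sub>R gauss_grad \<gamma> y x) (\<lambda>x. H x - \<epsilon> *\<^sub>R gauss_hess \<gamma> y x)"
      by (intro has_grad_hess_diff has_grad_hess_affine has_grad_hess_subset[OF assms(4)]
           gauss_bump_grad_hess) (use Usub assms(2) in blast)
    show "L z (G z - \<epsilon> *\<^sub>R gauss_grad \<gamma> y z) (H z - \<epsilon> *\<^sub>R gauss_hess \<gamma> y z) < 0"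
      if z: "z \<in> U" "w z - (\<epsilon> * ?h z + (- (\<epsilon> * e0))) < 0" for z
    proof -
      have "w z \<le> \<epsilon> * ?h z" using z mult_pos_pos[OF \<open>\<epsilon> > 0\<close> \<open>e0 > 0\<close>] by simp
      then have "L z (G z) (H z) \<le> Q * (\<epsilon> * ?h z)"
        using super[of z] z Usub \<open>0 \<le> Q\<close> by (meson mult_left_mono order_trans subsetD)
      moreover have "Q * ?h z < L z (gauss_grad \<gamma> y z) (gauss_hess \<gamma> y z)"
        using z Usub assms(2) by (intro \<gamma>(2)) (auto simp: U_def dist_commute)
      then have "\<epsilon> * (Q * ?h z) < \<epsilon> * L z (gauss_grad \<gamma> y z) (gauss_hess \<gamma> y z)"
        using \<open>\<epsilon> > 0\<close> by simp
      ultimately show ?thesis by (simp add: L_diff L_scale algebra_simps)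
    qed
    show "0 \<le> w z - (\<epsilon> * ?h z + (- (\<epsilon> * e0)))" if z: "z \<in> closure U - U" for z
    proof -
      have "z \<in> sphere y r \<or> z \<in> sphere y (r/2)" using z clU by (auto simp: U_def)
      then show ?thesis
      proof
        assume "z \<in> sphere y r"
        then have "?h z = e0"
          by (simp add: gauss_bump_def e0_def dot_square_norm dist_norm norm_minus_commute)
        then show ?thesis using nonneg \<open>z \<in> sphere y r\<close> by simp
      next
        assume "z \<in> sphere y (r/2)"
        then have "\<epsilon> \<le> w z" using \<epsilon> by blast
        moreover have "\<epsilon> * ?h z \<le> \<epsilon>" using \<gamma> \<epsilon> gauss_bump_le_1[of \<gamma> y z] by simp
        moreover have "0 < \<epsilon> * e0" using \<epsilon> \<open>e0 > 0\<close> by simp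
        ultimately show ?thesis by simp
      qed
    qed
    show "x \<in> closure U" by fact
  qed
  show ?thesis
  proof (rule that[of "\<epsilon> * e0 * \<gamma> * r\<^sup>2"])
    show "0 < \<epsilon> * e0 * \<gamma> * r\<^sup>2" using \<epsilon> \<gamma> \<open>e0 > 0\<close> \<open>0 < r\<close> by simp
    fix z t assume z: "z \<in> sphere y r" and t: "(0::real) < t" "t < 1/2"
    let ?x = "z + t *\<^sub>R (y - z)"
    have eq: "y - ?x = (1 - t) *\<^sub>R (y - z)" by (simp add: algebra_simps)
    have nx: "norm (y - ?x) = (1 - t) * r"
      unfolding eq using z t by (simp add: dist_norm)
    have "?x \<in> U"
      using t \<open>0 < r\<close> by (simp add: U_def dist_norm nx)
    then have "\<epsilon> * (?h ?x - e0) \<le> w ?x"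
      using on_U[of ?x] closure_subset[of U] by (auto simp: algebra_simps)
    moreover have "e0 * (\<gamma> * r\<^sup>2 * t) \<le> ?h ?x - e0"
    proof -
      have "?h ?x = exp (- \<gamma> * ((1 - t) * r)\<^sup>2)"
        unfolding gauss_bump_def dot_square_norm nx[symmetric] by (simp add: norm_minus_commute)
      \<comment> \<open>\<open>(1 - t)\<^sup>2 = 1 - (2 t - t\<^sup>2)\<close>, and \<open>2 t - t\<^sup>2 \<ge> t\<close> for \<open>t \<le> 1\<close>\<close>
      also have "- \<gamma> * ((1 - t) * r)\<^sup>2 = - \<gamma> * r\<^sup>2 + \<gamma> * r\<^sup>2 * (2 * t - t\<^sup>2)"
        by (simp add: algebra_simps power2_eq_square)
      finally have "?h ?x = e0 * exp (\<gamma> * r\<^sup>2 * (2 * t - t\<^sup>2))" by (simp add: e0_def flip: exp_add)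
      moreover have "t\<^sup>2 \<le> t" using t by (simp add: power2_eq_square)
      then have "\<gamma> * r\<^sup>2 * t \<le> \<gamma> * r\<^sup>2 * (2 * t - t\<^sup>2)"
        using \<gamma> by (intro mult_left_mono) auto
      then have "1 + \<gamma> * r\<^sup>2 * t \<le> exp (\<gamma> * r\<^sup>2 * (2 * t - t\<^sup>2))"
        using exp_ge_add_one_self[of "\<gamma> * r\<^sup>2 * (2 * t - t\<^sup>2)"] by linarith
      then have "e0 * (1 + \<gamma> * r\<^sup>2 * t) \<le> e0 * exp (\<gamma> * r\<^sup>2 * (2 * t - t\<^sup>2))"
        using \<open>e0 > 0\<close> by simp
      ultimately show ?thesis by (simp add: algebra_simps)
    qed
    then have "\<epsilon> * (e0 * (\<gamma> * r\<^sup>2 * t)) \<le> \<epsilon> * (?h ?x - e0)"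
      using \<epsilon> by simp
    ultimately show "\<epsilon> * e0 * \<gamma> * r\<^sup>2 * t \<le> w ?x" by (simp add: mult.assoc)
  qed
qed

text \<open>Hopf's lemma. The point \<open>z\<close> of the sphere may lie inside \<open>D\<close>, as in the strong minimum principle, or on its
  boundary, where the gradient is the limit \<open>p\<close>.\<close>

lemma hopf_gradient:
  assumes "0 < r" "ball y r \<subseteq> D" "continuous_on (closure D) w" "has_grad_hess D w G H"
    and "\<And>x. x \<in> ball y r \<Longrightarrow> L x (G x) (H x) \<le> Q * w x"
    and "\<And>x. x \<in> ball y r \<Longrightarrow> 0 < w x" and "\<And>x. x \<in> sphere y r \<Longrightarrow> 0 \<le> w x"
    and "0 \<le> Q" and z: "z \<in> sphere y r" "w z = 0" and G: "(G \<longlongrightarrow> p) (at z within D)"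
  shows "0 < p \<bullet> (y - z)"
proof -
  have cb: "cball y r \<subseteq> closure D"
    using assms(1,2) by (metis closure_ball closure_mono order_less_le)
  obtain \<kappa> where \<kappa>: "0 < \<kappa>" "\<And>z t. z \<in> sphere y r \<Longrightarrow> 0 < t \<Longrightarrow> t < 1/2 \<Longrightarrow> \<kappa> * t \<le> w (z + t *\<^sub>R (y - z))"
    using hopf_linear_growth[OF assms(1,2) continuous_on_subset[OF assms(3) cb] assms(4-8)] by blast
  have "\<kappa> \<le> p \<bullet> (y - z)"
  proof (rule le_directional_derivative[OF assms(3) G, where T = "1/4"])
    show "(w has_derivative (\<bullet>) (G x)) (at x)" if "x \<in> D" for x
      using assms(4) that by (auto simp: has_grad_hess_def)
    show "z + t *\<^sub>R (y - z) \<in> D - {z}" if t: "0 < t" "t \<le> 1/4" for t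
    proof -
      have eq: "y - (z + t *\<^sub>R (y - z)) = (1 - t) *\<^sub>R (y - z)" by (simp add: algebra_simps)
      have "norm (y - (z + t *\<^sub>R (y - z))) = (1 - t) * r"
        unfolding eq using z t by (simp add: dist_norm)
      then have "z + t *\<^sub>R (y - z) \<in> ball y r" using t \<open>0 < r\<close> by (simp add: dist_norm)
      moreover have "y \<noteq> z" using z \<open>0 < r\<close> by auto
      ultimately show ?thesis using assms(2) t by auto
    qed
  qed (use \<kappa>(2)[OF z(1)] z cb closure_subset in auto)
  then show ?thesis using \<kappa>(1) by simp
qed

text \<open>If the zero set in \<open>D\<close> were nonempty, connectedness would give a zero \<open>z0\<close> that is a limit of points where
  \<open>w > 0\<close>. Among the zeros nearest to such a point \<open>q\<close> close to \<open>z0\<close>, take \<open>z\<close>: then \<open>w > 0\<close> in the ball around \<open>q\<close>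
  through \<open>z\<close>, so Hopf's lemma gives a nonzero gradient at \<open>z\<close>, which is impossible at an interior minimum.\<close>

lemma strong_minimum_principle:
  assumes "connected D" "continuous_on (closure D) w" "has_grad_hess D w G H"
    and nonneg: "\<And>x. x \<in> D \<Longrightarrow> 0 \<le> w x"
    and super: "\<And>x. x \<in> D \<Longrightarrow> L x (G x) (H x) \<le> Q * w x" and "0 \<le> Q"
    and "x1 \<in> D" "0 < w x1" and "x \<in> D"
  shows "0 < w x"
proof (rule ccontr)
  assume "\<not> 0 < w x"
  define P where "P = {x \<in> D. 0 < w x}"
  have cw: "continuous_on D w" by (rule has_grad_hess_imp_continuous_on(1)[OF assms(3)])
  have "openin (top_of_set D) P"
  proof -
    have "P = D \<inter> w -` {0<..}" by (auto simp: P_def)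
    then show ?thesis using continuous_openin_preimage_gen[OF cw open_greaterThan] by simp
  qed
  moreover have "P \<noteq> {}" "P \<noteq> D" using assms(7-9) \<open>\<not> 0 < w x\<close> by (auto simp: P_def)
  ultimately have "\<not> closedin (top_of_set D) P" using \<open>connected D\<close> connected_clopen by blast
  then have "D \<inter> closure P \<noteq> P" by (metis closed_closure closedin_closed_Int)
  then obtain z0 where z0: "z0 \<in> D" "z0 \<in> closure P" "z0 \<notin> P"
    using closure_subset[of P] by (auto simp: P_def)
  then have "w z0 = 0" using nonneg[of z0] by (auto simp: P_def)
  obtain e where "e > 0" and e: "ball z0 e \<subseteq> D" using z0 open_D open_contains_ball by blast
  obtain q where q: "q \<in> P" "dist q z0 < e / 2"
    using z0(2) \<open>e > 0\<close> unfolding closure_approachable by (meson half_gt_zero)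
  \<comment> \<open>the zeros are sought only in a closed ball inside \<open>D\<close>, so that a nearest one exists\<close>
  define C where "C = {x \<in> cball q (dist q z0). w x = 0}"
  have sub: "cball q (dist q z0) \<subseteq> D"
  proof
    fix x assume "x \<in> cball q (dist q z0)"
    then have "dist z0 x < e" using q dist_triangle[of z0 x q] by (simp add: dist_commute)
    then show "x \<in> D" using e by auto
  qed
  have "closed C"
    unfolding C_def by (intro continuous_closed_preimage_constant continuous_on_subset[OF cw sub]) auto
  then have "compact C" unfolding C_def by (metis (no_types, lifting) bounded_cball bounded_subset compact_eq_bounded_closed mem_Collect_eq subsetI)
  moreover have "z0 \<in> C" using \<open>w z0 = 0\<close> by (simp add: C_def)
  ultimately obtain z where z: "z \<in> C" "\<And>x. x \<in> C \<Longrightarrow> dist q z \<le> dist q x"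
    using continuous_attains_inf[of C "dist q"] continuous_on_dist[OF continuous_on_const continuous_on_id]
    by (metis empty_iff)
  define r where "r = dist q z"
  have "w z = 0" using z by (simp add: C_def)
  have "r \<le> dist q z0" using z \<open>z0 \<in> C\<close> by (simp add: r_def)
  then have cbr: "cball q r \<subseteq> D" using sub by force
  have zD: "z \<in> D" using z sub by (auto simp: C_def)
  have "r > 0" using q \<open>w z = 0\<close> by (auto simp: r_def P_def)
  have posb: "0 < w x" if "x \<in> ball q r" for x
  proof -
    have "x \<notin> C" using z(2)[of x] that by (auto simp: r_def)
    then have "w x \<noteq> 0" using that \<open>r \<le> dist q z0\<close> by (auto simp: C_def)
    moreover have "x \<in> D" using that cbr by auto
    ultimately show ?thesis using nonneg[of x] by simp
  qed
  have "0 < G z \<bullet> (q - z)"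
  proof (rule hopf_gradient[OF \<open>r > 0\<close> _ assms(2,3)])
    show "(G \<longlongrightarrow> G z) (at z within D)"
      using has_grad_hess_imp_continuous_on(2)[OF assms(3)] zD by (auto simp: continuous_on_def)
    show "z \<in> sphere q r" by (simp add: r_def)
    have "ball q r \<subseteq> cball q r" "sphere q r \<subseteq> cball q r" by auto
    then show "ball q r \<subseteq> D" "\<And>x. x \<in> sphere q r \<Longrightarrow> 0 \<le> w x"
      "\<And>x. x \<in> ball q r \<Longrightarrow> L x (G x) (H x) \<le> Q * w x"
      using cbr nonneg super by blast+
  qed (fact posb \<open>0 \<le> Q\<close> \<open>w z = 0\<close>)+
  moreover have "G z = 0"
    using interior_min_grad_hess(1)[OF open_D zD assms(3)] nonneg \<open>w z = 0\<close> by simp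
  ultimately show False by simp
qed

end

section \<open>The divergence form operator in nondivergence form\<close>

text \<open>This class contains the entries of \<open>a\<close> and is closed under the operations that form
  \<open>|det a| powr s\<close> and its products with those entries. It gives both the differentiability needed to expand the divergence
  and the bound on the first order coefficients.\<close>

definition bounded_partials :: "(real^'n::finite) set \<Rightarrow> (real^'n \<Rightarrow> real) \<Rightarrow> bool" where
  "bounded_partials D f \<longleftrightarrow> (\<exists>d B. \<forall>x\<in>D. \<bar>f x\<bar> \<le> B \<and>
     (\<forall>i. ((\<lambda>t. f (x + t *\<^sub>R axis i 1)) has_real_derivative d i x) (at 0) \<and> \<bar>d i x\<bar> \<le> B))"

lemma bounded_partialsI:
  assumes "\<And>x. x \<in> D \<Longrightarrow> \<bar>f x\<bar> \<le> B"
    "\<And>x i. x \<in> D \<Longrightarrow> ((\<lambda>t. f (x + t *\<^sub>R axis i 1)) has_real_derivative d i x) (at 0)"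
    "\<And>x i. x \<in> D \<Longrightarrow> \<bar>d i x\<bar> \<le> C"
  shows "bounded_partials D f"
  unfolding bounded_partials_def
  using assms by (intro exI[of _ d] exI[of _ "max B C"]) (auto simp: le_max_iff_disj)

lemma bounded_partialsE:
  assumes "bounded_partials D f"
  obtains d B where "0 \<le> B" "\<And>x. x \<in> D \<Longrightarrow> \<bar>f x\<bar> \<le> B"
    "\<And>x i. x \<in> D \<Longrightarrow> ((\<lambda>t. f (x + t *\<^sub>R axis i 1)) has_real_derivative d i x) (at 0)"
    "\<And>x i. x \<in> D \<Longrightarrow> \<bar>d i x\<bar> \<le> B"
proof -
  obtain d B where "\<forall>x\<in>D. \<bar>f x\<bar> \<le> B \<and>
     (\<forall>i. ((\<lambda>t. f (x + t *\<^sub>R axis i 1)) has_real_derivative d i x) (at 0) \<and> \<bar>d i x\<bar> \<le> B)"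
    using assms unfolding bounded_partials_def by blast
  then show ?thesis using that[of "\<bar>B\<bar>" d] by fastforce
qed

lemma bounded_partials_partial:
  assumes "bounded_partials D f"
  obtains B where "\<And>x. x \<in> D \<Longrightarrow> \<bar>f x\<bar> \<le> B" "\<And>x i. x \<in> D \<Longrightarrow> \<bar>partial i f x\<bar> \<le> B"
    "\<And>x i. x \<in> D \<Longrightarrow> ((\<lambda>t. f (x + t *\<^sub>R axis i 1)) has_real_derivative partial i f x) (at 0)"
proof -
  obtain d B where d: "\<And>x. x \<in> D \<Longrightarrow> \<bar>f x\<bar> \<le> B"
    "\<And>x i. x \<in> D \<Longrightarrow> ((\<lambda>t. f (x + t *\<^sub>R axis i 1)) has_real_derivative d i x) (at 0)"
    "\<And>x i. x \<in> D \<Longrightarrow> \<bar>d i x\<bar> \<le> B"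
    using bounded_partialsE[OF assms] by metis
  have "partial i f x = d i x" if "x \<in> D" for x i
    using d(2)[OF that] by (simp add: partial_def DERIV_imp_deriv)
  then show ?thesis using d that[of B] by simp
qed

lemma bounded_partials_const: "bounded_partials D (\<lambda>x. c)"
  by (rule bounded_partialsI[where B = "\<bar>c\<bar>" and C = 0 and d = "\<lambda>i x. 0"]) auto

lemma bounded_partials_add:
  assumes "bounded_partials D f" "bounded_partials D g"
  shows "bounded_partials D (\<lambda>x. f x + g x)"
proof -
  obtain d B where f: "0 \<le> B" "\<And>x. x \<in> D \<Longrightarrow> \<bar>f x\<bar> \<le> B"
    "\<And>x i. x \<in> D \<Longrightarrow> ((\<lambda>t. f (x + t *\<^sub>R axis i 1)) has_real_derivative d i x) (at 0)"
    "\<And>x i. x \<in> D \<Longrightarrow> \<bar>d i x\<bar> \<le> B"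
    using bounded_partialsE[OF assms(1)] by metis
  obtain e C where g: "0 \<le> C" "\<And>x. x \<in> D \<Longrightarrow> \<bar>g x\<bar> \<le> C"
    "\<And>x i. x \<in> D \<Longrightarrow> ((\<lambda>t. g (x + t *\<^sub>R axis i 1)) has_real_derivative e i x) (at 0)"
    "\<And>x i. x \<in> D \<Longrightarrow> \<bar>e i x\<bar> \<le> C"
    using bounded_partialsE[OF assms(2)] by metis
  show ?thesis
  proof (rule bounded_partialsI[where B = "B + C" and C = "B + C" and d = "\<lambda>i x. d i x + e i x"])
    fix x i assume x: "x \<in> D"
    show "\<bar>f x + g x\<bar> \<le> B + C" using f(2)[OF x] g(2)[OF x] by linarith
    show "\<bar>d i x + e i x\<bar> \<le> B + C" using f(4)[OF x, of i] g(4)[OF x, of i] by linarith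
  qed (intro DERIV_add f g)
qed

lemma bounded_partials_mult:
  assumes "bounded_partials D f" "bounded_partials D g"
  shows "bounded_partials D (\<lambda>x. f x * g x)"
proof -
  obtain d B where f: "0 \<le> B" "\<And>x. x \<in> D \<Longrightarrow> \<bar>f x\<bar> \<le> B"
    "\<And>x i. x \<in> D \<Longrightarrow> ((\<lambda>t. f (x + t *\<^sub>R axis i 1)) has_real_derivative d i x) (at 0)"
    "\<And>x i. x \<in> D \<Longrightarrow> \<bar>d i x\<bar> \<le> B"
    using bounded_partialsE[OF assms(1)] by metis
  obtain e C where g: "0 \<le> C" "\<And>x. x \<in> D \<Longrightarrow> \<bar>g x\<bar> \<le> C"
    "\<And>x i. x \<in> D \<Longrightarrow> ((\<lambda>t. g (x + t *\<^sub>R axis i 1)) has_real_derivative e i x) (at 0)"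
    "\<And>x i. x \<in> D \<Longrightarrow> \<bar>e i x\<bar> \<le> C"
    using bounded_partialsE[OF assms(2)] by metis
  show ?thesis
  proof (rule bounded_partialsI[where B = "B * C" and C = "B * C + C * B"
        and d = "\<lambda>i x. d i x * g x + e i x * f x"])
    fix x i assume x: "x \<in> D"
    show "\<bar>f x * g x\<bar> \<le> B * C" using f(1,2) g(1,2) x by (simp add: abs_mult mult_mono)
    have "\<bar>d i x * g x\<bar> \<le> B * C" "\<bar>e i x * f x\<bar> \<le> C * B"
      using f(1,2,4) g(1,2,4) x by (simp_all add: abs_mult mult_mono)
    then show "\<bar>d i x * g x + e i x * f x\<bar> \<le> B * C + C * B" by linarith
    show "((\<lambda>t. f (x + t *\<^sub>R axis i 1) * g (x + t *\<^sub>R axis i 1)) has_real_derivative d i x * g x + e i x * f x) (at 0)"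
      using DERIV_mult[OF f(3)[OF x] g(3)[OF x]] by simp
  qed
qed

lemma bounded_partials_sum:
  assumes "\<And>s. s \<in> S \<Longrightarrow> bounded_partials D (f s)"
  shows "bounded_partials D (\<lambda>x. \<Sum>s\<in>S. f s x)"
  using assms by (induction S rule: infinite_finite_induct)
    (auto intro: bounded_partials_const bounded_partials_add)

lemma bounded_partials_prod:
  assumes "\<And>s. s \<in> S \<Longrightarrow> bounded_partials D (f s)"
  shows "bounded_partials D (\<lambda>x. \<Prod>s\<in>S. f s x)"
  using assms by (induction S rule: infinite_finite_induct)
    (auto intro: bounded_partials_const bounded_partials_mult)

lemma bounded_partials_det:
  assumes "\<And>i j. bounded_partials D (\<lambda>x. a x $ i $ j)"
  shows "bounded_partials D (\<lambda>x. det (a x))"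
  unfolding det_def
  by (intro bounded_partials_sum bounded_partials_mult bounded_partials_const bounded_partials_prod assms)

lemma bounded_partials_powr:
  assumes "bounded_partials D f" "0 < m" "\<And>x. x \<in> D \<Longrightarrow> m \<le> f x"
  shows "bounded_partials D (\<lambda>x. f x powr s)"
proof -
  obtain d B where f: "0 \<le> B" "\<And>x. x \<in> D \<Longrightarrow> \<bar>f x\<bar> \<le> B"
    "\<And>x i. x \<in> D \<Longrightarrow> ((\<lambda>t. f (x + t *\<^sub>R axis i 1)) has_real_derivative d i x) (at 0)"
    "\<And>x i. x \<in> D \<Longrightarrow> \<bar>d i x\<bar> \<le> B"
    using bounded_partialsE[OF assms(1)] by metis
  have "\<exists>K. \<forall>z\<in>{m..B}. \<bar>z powr q\<bar> \<le> K" for q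
  proof -
    have "continuous_on {m..B} (\<lambda>z. z powr q)"
      using assms(2) by (intro continuous_intros) auto
    then have "compact ((\<lambda>z. z powr q) ` {m..B})" by (rule compact_continuous_image) simp
    from compact_imp_bounded[OF this] show ?thesis by (auto simp: bounded_iff)
  qed
  then obtain K where K: "\<And>q z. z \<in> {m..B} \<Longrightarrow> \<bar>z powr q\<bar> \<le> K q" by metis
  have rng: "f x \<in> {m..B}" if "x \<in> D" for x using f(2)[OF that] assms(3)[OF that] by auto
  show ?thesis
  proof (rule bounded_partialsI[where B = "K s" and C = "(\<bar>s\<bar> * K (s - 1)) * B"
        and d = "\<lambda>i x. s * f x powr (s - 1) * d i x"])
    fix x i assume x: "x \<in> D"
    show "\<bar>f x powr s\<bar> \<le> K s" by (rule K[OF rng[OF x]])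
    have "0 < f x" using assms(2,3) x by force
    have "0 \<le> K (s - 1)" using K[OF rng[OF x], of "s - 1"] by linarith
    then show "\<bar>s * f x powr (s - 1) * d i x\<bar> \<le> (\<bar>s\<bar> * K (s - 1)) * B"
      unfolding abs_mult using K[OF rng[OF x], of "s - 1"] f(4)[OF x, of i]
      by (intro mult_mono) (auto intro!: mult_nonneg_nonneg)
    have "((\<lambda>z. z powr s) has_real_derivative s * f x powr (s - 1)) (at (f (x + 0 *\<^sub>R axis i 1)))"
      using has_real_derivative_powr[OF \<open>0 < f x\<close>, of s] by simp
    from DERIV_chain2[OF this f(3)[OF x]]
    show "((\<lambda>t. f (x + t *\<^sub>R axis i 1) powr s) has_real_derivative s * f x powr (s - 1) * d i x) (at 0)" .
  qed
qed

lemma C_closure_Suc_bounded_partials: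
  fixes f :: "real^'n::finite \<Rightarrow> real"
  assumes "bounded D" "C_closure (Suc k) D f"
  shows "bounded_partials D f"
proof -
  have bd: "\<exists>B. \<forall>x\<in>D. \<bar>q x\<bar> \<le> B" if "continuous_on (closure D) q" for q :: "real^'n \<Rightarrow> real"
  proof -
    have "compact (q ` closure D)" using that assms(1) by (intro compact_continuous_image) simp_all
    from compact_imp_bounded[OF this] obtain B where "\<forall>x\<in>closure D. \<bar>q x\<bar> \<le> B"
      by (auto simp: bounded_iff)
    then show ?thesis using closure_subset by blast
  qed
  have cont: "continuous_on (closure D) q" if "C_closure k D q" for q
    using that by (cases k) auto
  obtain h where h: "\<And>i. C_closure k D (h i)"
    "\<And>i x. x \<in> D \<Longrightarrow> ((\<lambda>t. f (x + t *\<^sub>R axis i 1)) has_real_derivative h i x) (at 0)"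
    using assms(2) by simp metis
  obtain B where B: "\<And>i x. x \<in> D \<Longrightarrow> \<bar>h i x\<bar> \<le> B i"
    using bd[OF cont[OF h(1)]] by metis
  have "continuous_on (closure D) f" using assms(2) by simp
  from bd[OF this] obtain B0 where B0: "\<And>x. x \<in> D \<Longrightarrow> \<bar>f x\<bar> \<le> B0" by blast
  show ?thesis
  proof (rule bounded_partialsI[where d = h])
    show "\<bar>h i x\<bar> \<le> Max (range B)" if "x \<in> D" for x i
      by (rule order_trans[OF B[OF that] Max_ge]) auto
  qed (use h B0 in auto)
qed

lemma quadratic_form_eq:
  fixes A :: "real^'n::finite^'n"
  shows "\<xi> \<bullet> (A *v \<xi>) = (\<Sum>i\<in>UNIV. \<Sum>j\<in>UNIV. A $ i $ j * \<xi> $ i * \<xi> $ j)"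
  by (simp add: inner_vec_def matrix_vector_mult_def sum_distrib_left mult_ac)

text \<open>By the product rule, \<open>b\<^sub>k = |det a| powr (1/2) * (\<Sum>i. \<partial>\<^sub>i (|det a| powr (-1/2) a\<^sub>i\<^sub>k))\<close>. Ellipticity
  makes \<open>det a\<close> nonzero on the compact closure, hence bounded away from zero, so the powers have
  bounded derivatives.\<close>

lemma div_operator_nondivergence_form:
  fixes a :: "real^'n::finite \<Rightarrow> real^'n^'n"
  assumes "open D" "bounded D" "D \<noteq> {}"
    and C2: "\<And>i j. C_closure 2 D (\<lambda>x. a x $ i $ j)"
    and sym: "\<And>x i j. x \<in> closure D \<Longrightarrow> a x $ i $ j = a x $ j $ i"
    and "0 < c" and ell: "\<And>x \<xi>. x \<in> closure D \<Longrightarrow> c * (norm \<xi>)\<^sup>2 \<le> \<xi> \<bullet> (a x *v \<xi>)"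
  obtains b B where "elliptic_operator D a b c B"
    "\<And>u G H x. has_grad_hess D u G H \<Longrightarrow> x \<in> D \<Longrightarrow>
       div_operator a u x = - elliptic_operator.L a b x (G x) (H x)"
proof -
  have bp: "bounded_partials D (\<lambda>x. a x $ i $ j)" for i j
    using C_closure_Suc_bounded_partials[OF assms(2), of "Suc 0"] C2[of i j] by (simp add: numeral_2_eq_2)
  have "continuous_on (closure D) (\<lambda>x. a x $ i $ j)" for i j
    using C2[of i j] by (simp add: numeral_2_eq_2)
  then have cdet: "continuous_on (closure D) (\<lambda>x. (det (a x))\<^sup>2)"
    unfolding det_def
    by (intro continuous_on_power continuous_on_sum continuous_on_mult continuous_on_prod continuous_on_const)
  have det_nz: "det (a x) \<noteq> 0" if "x \<in> closure D" for x
  proof -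
    have "\<xi> = 0" if "a x *v \<xi> = 0" for \<xi>
      using ell[OF \<open>x \<in> closure D\<close>, of \<xi>] that \<open>0 < c\<close> by (simp add: mult_le_0_iff)
    then have "invertible (a x)" by (simp add: invertible_left_inverse matrix_left_invertible_ker)
    then show ?thesis by (simp add: invertible_det_nz)
  qed
  obtain z where z: "z \<in> closure D" "\<And>x. x \<in> closure D \<Longrightarrow> (det (a z))\<^sup>2 \<le> (det (a x))\<^sup>2"
    using continuous_attains_inf[OF _ _ cdet] assms(2,3) by auto
  \<comment> \<open>removes the absolute value, which is not differentiable, from the powers of the determinant\<close>
  have powr_eq: "\<bar>e\<bar> powr s = (e\<^sup>2) powr (s / 2)" for e s :: real
  proof -
    have "e\<^sup>2 = \<bar>e\<bar> powr 2" by (cases "e = 0") (simp_all add: powr_numeral)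
    then show ?thesis by (simp only: powr_powr) simp
  qed
  have bpow: "bounded_partials D (\<lambda>x. \<bar>det (a x)\<bar> powr s)" for s
    unfolding powr_eq[of _ s]
  proof (rule bounded_partials_powr)
    show "bounded_partials D (\<lambda>x. (det (a x))\<^sup>2)"
      unfolding power2_eq_square by (intro bounded_partials_mult bounded_partials_det bp)
    show "0 < (det (a z))\<^sup>2" using det_nz[OF z(1)] by simp
    show "(det (a z))\<^sup>2 \<le> (det (a x))\<^sup>2" if "x \<in> D" for x
      using z(2) that closure_subset by blast
  qed
  define W where "W = (\<lambda>i k y. \<bar>det (a y)\<bar> powr (-1/2) * a y $ i $ k)"
  have bW: "bounded_partials D (W i k)" for i k
    unfolding W_def by (intro bounded_partials_mult bpow bp)
  define b where "b = (\<lambda>x. \<chi> k. \<bar>det (a x)\<bar> powr (1/2) * (\<Sum>i\<in>UNIV. partial i (W i k) x))"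
  have "\<exists>B. \<forall>x\<in>D. \<bar>partial i (W i k) x\<bar> \<le> B" for i k
    using bounded_partials_partial[OF bW[of i k]] by metis
  then obtain BW where BW: "\<And>i k x. x \<in> D \<Longrightarrow> \<bar>partial i (W i k) x\<bar> \<le> BW i k" by metis
  have "\<exists>B. \<forall>x\<in>D. \<bar>a x $ i $ i\<bar> \<le> B" for i
    using bounded_partials_partial[OF bp[of i i]] by metis
  then obtain Ba where Ba: "\<And>i x. x \<in> D \<Longrightarrow> \<bar>a x $ i $ i\<bar> \<le> Ba i" by metis
  obtain Bd where Bd: "\<And>x. x \<in> D \<Longrightarrow> \<bar>\<bar>det (a x)\<bar> powr (1/2)\<bar> \<le> Bd"
    using bounded_partials_partial[OF bpow[of "1/2"]] by metis
  define B where "B = max (\<Sum>i\<in>UNIV. Ba i) (\<Sum>k\<in>UNIV. Bd * (\<Sum>i\<in>UNIV. BW i k))"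
  have op: "elliptic_operator D a b c B"
  proof
    fix x assume x: "x \<in> D"
    then have xc: "x \<in> closure D" using closure_subset by blast
    show "a x $ i $ j = a x $ j $ i" for i j by (rule sym[OF xc])
    show "c * (norm \<xi>)\<^sup>2 \<le> \<xi> \<bullet> (a x *v \<xi>)" for \<xi> by (rule ell[OF xc])
    have "trace (a x) \<le> (\<Sum>i\<in>UNIV. Ba i)"
      unfolding trace_def by (intro sum_mono) (use Ba[OF x] abs_le_D1 in blast)
    then show "trace (a x) \<le> B" by (simp add: B_def)
    have "norm (b x) \<le> (\<Sum>k\<in>UNIV. \<bar>b x $ k\<bar>)" by (rule norm_le_l1_cart)
    also have "\<dots> \<le> (\<Sum>k\<in>UNIV. Bd * (\<Sum>i\<in>UNIV. BW i k))"
    proof (rule sum_mono)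
      fix k
      have "\<bar>\<Sum>i\<in>UNIV. partial i (W i k) x\<bar> \<le> (\<Sum>i\<in>UNIV. BW i k)"
        by (rule order_trans[OF sum_abs]) (intro sum_mono BW x)
      then show "\<bar>b x $ k\<bar> \<le> Bd * (\<Sum>i\<in>UNIV. BW i k)"
        using Bd[OF x] order_trans[OF abs_ge_zero Bd[OF x]] by (simp add: b_def abs_mult mult_mono)
    qed
    finally show "norm (b x) \<le> B" by (simp add: B_def)
  qed fact+
  have "div_operator a u x = - elliptic_operator.L a b x (G x) (H x)"
    if gh: "has_grad_hess D u G H" and x: "x \<in> D" for u G H x
  proof -
    have xc: "x \<in> closure D" using closure_subset x by blast
    have du: "(u has_derivative (\<lambda>v. G y \<bullet> v)) (at y)"
      and dG: "(G has_derivative (\<lambda>v. H y *v v)) (at y)" if "y \<in> D" for y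
      using gh that by (auto simp: has_grad_hess_def)
    have pu: "partial k u y = G y $ k" if "y \<in> D" for k y
    proof -
      have "((\<lambda>t. u (y + t *\<^sub>R axis k 1)) has_real_derivative G y \<bullet> axis k 1) (at 0)"
        by (rule has_derivative_along_line) (simp add: du that)
      then show ?thesis by (simp add: partial_def DERIV_imp_deriv inner_axis)
    qed
    have key: "partial i (\<lambda>y. W i k y * partial k u y) x = partial i (W i k) x * G x $ k + W i k x * H x $ k $ i"
      for i k
    proof -
      have "((\<lambda>y. G y $ k) has_derivative (\<lambda>v. H x $ k \<bullet> v)) (at x)"
        using bounded_linear.has_derivative[OF bounded_linear_vec_nth dG[OF x], of k] by (simp add: matrix_vector_mul_component)
      then have "((\<lambda>t. G (x + t *\<^sub>R axis i 1) $ k) has_real_derivative H x $ k \<bullet> axis i 1) (at 0)"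
        by (intro has_derivative_along_line) simp
      then have dGk: "((\<lambda>t. G (x + t *\<^sub>R axis i 1) $ k) has_real_derivative H x $ k $ i) (at 0)"
        by (simp add: inner_axis)
      have dW: "((\<lambda>t. W i k (x + t *\<^sub>R axis i 1)) has_real_derivative partial i (W i k) x) (at 0)"
        using bounded_partials_partial[OF bW] x by metis
      have d1: "((\<lambda>t. W i k (x + t *\<^sub>R axis i 1) * G (x + t *\<^sub>R axis i 1) $ k) has_real_derivative
          partial i (W i k) x * G x $ k + W i k x * H x $ k $ i) (at 0)"
        using DERIV_mult[OF dW dGk] by (simp add: mult.commute)
      have "((\<lambda>t. x + t *\<^sub>R axis i 1) \<longlongrightarrow> x + 0 *\<^sub>R axis i 1) (at 0)"
        by (intro tendsto_intros)
      then have "\<forall>\<^sub>F t in at 0. x + t *\<^sub>R axis i 1 \<in> D"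
        using \<open>open D\<close> x by (intro topological_tendstoD) auto
      then have ev: "\<forall>\<^sub>F t in nhds 0. x + t *\<^sub>R axis i 1 \<in> D"
        using x by (simp add: eventually_nhds_conv_at)
      have "((\<lambda>t. W i k (x + t *\<^sub>R axis i 1) * partial k u (x + t *\<^sub>R axis i 1)) has_real_derivative
          partial i (W i k) x * G x $ k + W i k x * H x $ k $ i) (at 0)"
        using d1
      proof (rule DERIV_cong_ev[THEN iffD2, rotated -1])
        show "\<forall>\<^sub>F t in nhds 0. W i k (x + t *\<^sub>R axis i 1) * partial k u (x + t *\<^sub>R axis i 1) =
            W i k (x + t *\<^sub>R axis i 1) * G (x + t *\<^sub>R axis i 1) $ k"
          using ev by eventually_elim (simp add: pu)
      qed simp_all
      then show ?thesis unfolding partial_def[of i "\<lambda>y. W i k y * partial k u y"]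
        by (rule DERIV_imp_deriv)
    qed
    let ?s = "\<bar>det (a x)\<bar> powr (1/2)"
    have sW: "?s * W i k x = a x $ i $ k" for i k
      using det_nz[OF xc] by (simp add: W_def flip: mult.assoc powr_add)
    have "- div_operator a u x = ?s * (\<Sum>i\<in>UNIV. \<Sum>k\<in>UNIV. partial i (W i k) x * G x $ k + W i k x * H x $ k $ i)"
      unfolding div_operator_def key[symmetric] by (simp add: W_def)
    also have "\<dots> = (\<Sum>i\<in>UNIV. \<Sum>k\<in>UNIV. ?s * partial i (W i k) x * G x $ k) +
        (\<Sum>i\<in>UNIV. \<Sum>k\<in>UNIV. a x $ i $ k * H x $ k $ i)"
      unfolding sW[symmetric] by (simp add: sum_distrib_left distrib_left sum.distrib mult.assoc)
    also have "(\<Sum>i\<in>UNIV. \<Sum>k\<in>UNIV. ?s * partial i (W i k) x * G x $ k) = b x \<bullet> G x"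
      by (subst sum.swap) (simp add: b_def inner_vec_def sum_distrib_left sum_distrib_right)
    also have "(\<Sum>i\<in>UNIV. \<Sum>k\<in>UNIV. a x $ i $ k * H x $ k $ i) =
        (\<Sum>k\<in>UNIV. \<Sum>i\<in>UNIV. a x $ k $ i * H x $ k $ i)"
      by (subst sum.swap) (simp add: sym[OF xc] cong: sum.cong)
    finally show ?thesis by (simp add: elliptic_operator.L_def[OF op])
  qed
  then show ?thesis using op that by blast
qed

section \<open>Boundary given by graphs: interior ball and tangent directions\<close>

text \<open>The Hessian is bounded on the compact closed ball, so the gradient is Lipschitz, and so the error of the
  linear approximation has a gradient of size at most \<open>K |x - p|\<close> on the segment from \<open>p\<close> to \<open>x\<close>.\<close>

lemma second_order_taylor_bound:
  fixes f :: "real^'n::finite \<Rightarrow> real"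
  assumes "has_grad_hess (ball p r) f G H"
    and cH: "\<And>i j. continuous_on (closure (ball p r)) (\<lambda>x. H x $ i $ j)"
  obtains K where "0 < K" "\<And>x. x \<in> ball p r \<Longrightarrow> \<bar>f x - f p - G p \<bullet> (x - p)\<bar> \<le> K * (norm (x - p))\<^sup>2"
proof -
  have "\<exists>B. \<forall>x\<in>ball p r. \<bar>H x $ i $ j\<bar> \<le> B" for i j
  proof -
    have "compact ((\<lambda>x. H x $ i $ j) ` closure (ball p r))"
      by (intro compact_continuous_image cH) simp
    from compact_imp_bounded[OF this] obtain B where "\<forall>x\<in>closure (ball p r). \<bar>H x $ i $ j\<bar> \<le> B"
      by (auto simp: bounded_iff)
    then show ?thesis using closure_subset[of "ball p r"] by blast
  qed
  then obtain B where B: "\<And>i j x. x \<in> ball p r \<Longrightarrow> \<bar>H x $ i $ j\<bar> \<le> B i j" by metis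
  define K where "K = (\<Sum>i\<in>UNIV. \<Sum>j\<in>UNIV. \<bar>B i j\<bar>) + 1"
  have "0 \<le> (\<Sum>i\<in>UNIV. \<Sum>j\<in>UNIV. \<bar>B i j\<bar>)" by (intro sum_nonneg) auto
  then have "K > 0" by (simp add: K_def)
  have Hb: "norm (H x *v v) \<le> K * norm v" if x: "x \<in> ball p r" for x v
  proof -
    have "norm (H x *v v) \<le> (\<Sum>i\<in>UNIV. \<bar>(H x *v v) $ i\<bar>)" by (rule norm_le_l1_cart)
    also have "\<dots> \<le> (\<Sum>i\<in>UNIV. \<Sum>j\<in>UNIV. \<bar>B i j\<bar> * norm v)"
    proof (rule sum_mono)
      fix i
      have "\<bar>(H x *v v) $ i\<bar> \<le> (\<Sum>j\<in>UNIV. \<bar>H x $ i $ j * v $ j\<bar>)"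
        unfolding matrix_vector_mult_def by simp
      also have "\<dots> \<le> (\<Sum>j\<in>UNIV. \<bar>B i j\<bar> * norm v)"
        unfolding abs_mult
        by (intro sum_mono mult_mono component_le_norm_cart order_trans[OF B[OF x]]) auto
      finally show "\<bar>(H x *v v) $ i\<bar> \<le> (\<Sum>j\<in>UNIV. \<bar>B i j\<bar> * norm v)" .
    qed
    also have "\<dots> = (\<Sum>i\<in>UNIV. \<Sum>j\<in>UNIV. \<bar>B i j\<bar>) * norm v" by (simp add: sum_distrib_right)
    also have "\<dots> \<le> K * norm v" unfolding K_def by (intro mult_right_mono) auto
    finally show ?thesis .
  qed
  have dG: "(G has_derivative (\<lambda>v. H x *v v)) (at x)"
    and df: "(f has_derivative (\<lambda>v. G x \<bullet> v)) (at x)" if "x \<in> ball p r" for x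
    using assms(1) that by (auto simp: has_grad_hess_def)
  have lip: "norm (G x - G p) \<le> K * norm (x - p)" if x: "x \<in> ball p r" for x
  proof (rule differentiable_bound[where S = "ball p r"])
    show "(G has_derivative (\<lambda>v. H y *v v)) (at y within ball p r)" if "y \<in> ball p r" for y
      using dG[OF that] by (rule has_derivative_at_withinI)
    show "onorm ((*v) (H y)) \<le> K" if "y \<in> ball p r" for y
      by (rule onorm_le) (rule Hb[OF that])
  qed (use x in \<open>auto intro: le_less_trans[OF zero_le_dist]\<close>)
  have "\<bar>f x - f p - G p \<bullet> (x - p)\<bar> \<le> K * (norm (x - p))\<^sup>2" if x: "x \<in> ball p r" for x
  proof -
    have p: "p \<in> ball p r" using x by (auto intro: le_less_trans[OF zero_le_dist])
    have seg: "closed_segment p x \<subseteq> ball p r" using p x by (intro closed_segment_subset) auto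
    have "norm ((f x - G p \<bullet> x) - (f p - G p \<bullet> p)) \<le> (K * norm (x - p)) * norm (x - p)"
    proof (rule differentiable_bound[where S = "closed_segment p x" and f' = "\<lambda>y v. (G y - G p) \<bullet> v"])
      fix y assume y: "y \<in> closed_segment p x"
      have "(f has_derivative (\<lambda>v. G y \<bullet> v)) (at y within closed_segment p x)"
        using df seg y by (blast intro: has_derivative_at_withinI)
      then show "((\<lambda>y. f y - G p \<bullet> y) has_derivative (\<lambda>v. (G y - G p) \<bullet> v)) (at y within closed_segment p x)"
        by (auto intro!: derivative_eq_intros simp: inner_diff_left)
      have "norm (G y - G p) \<le> K * norm (y - p)" using lip seg y by blast
      also have "\<dots> \<le> K * norm (x - p)"
        using segment_bound(1)[OF y] \<open>K > 0\<close> by simp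
      finally show "onorm ((\<bullet>) (G y - G p)) \<le> K * norm (x - p)"
        by (intro onorm_le) (simp add: order_trans[OF Cauchy_Schwarz_ineq2] mult_right_mono)
    qed auto
    then show ?thesis by (simp add: inner_diff_right power2_eq_square algebra_simps)
  qed
  then show ?thesis using that \<open>K > 0\<close> by blast
qed

text \<open>The vector is \<open>N = \<sigma> (e\<^sub>k - \<nabla>\<gamma>(p))\<close>. With \<open>d = x - p\<close>, the height \<open>\<sigma> (x\<^sub>k - \<gamma> x)\<close> of a point over the
  graph is \<open>N \<bullet> d\<close> up to an error of at most \<open>K |d|\<^sup>2\<close>, while \<open>|d|\<^sup>2 < 2 s (N \<bullet> d)\<close> in the ball with centre
  \<open>p + s N\<close> that touches the boundary at \<open>p\<close>; so this ball lies in \<open>D\<close> if \<open>2 s K \<le> 1\<close>. The curve with velocity \<open>\<tau>\<close> is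
  the line \<open>p + t \<tau>\<close> moved onto the graph in the direction \<open>e\<^sub>k\<close>.\<close>

lemma boundary_graph_normal:
  fixes D :: "(real^'n::finite) set"
  assumes "open D" "boundary_graph \<alpha> D p r k \<sigma> \<gamma>" "p \<in> frontier D"
  obtains N s where "N \<noteq> 0" "0 < s" "ball (p + s *\<^sub>R N) (s * norm N) \<subseteq> D"
    "\<And>\<tau>. N \<bullet> \<tau> = 0 \<Longrightarrow>
      \<exists>c. c 0 = p \<and> (\<forall>t. c t \<in> frontier D) \<and> (c has_vector_derivative \<tau>) (at (0::real))"
proof -
  have "0 < r" and \<sigma>: "\<sigma> * \<sigma> = 1" "\<bar>\<sigma>\<bar> = 1" and C2: "C_holder_closure 2 \<alpha> (ball p r) \<gamma>"
    and indep: "\<And>x y. x \<in> ball p r \<Longrightarrow> y \<in> ball p r \<Longrightarrow> (\<And>j. j \<noteq> k \<Longrightarrow> x $ j = y $ j) \<Longrightarrow> \<gamma> x = \<gamma> y"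
    and D: "\<And>x. x \<in> ball p r \<Longrightarrow> x \<in> D \<longleftrightarrow> 0 < \<sigma> * (x $ k - \<gamma> x)"
  proof -
    have "0 < r \<and> \<sigma> \<in> {-1, 1} \<and> C_holder_closure 2 \<alpha> (ball p r) \<gamma> \<and>
      (\<forall>x\<in>ball p r. x \<in> D \<longleftrightarrow> 0 < \<sigma> * (x $ k - \<gamma> x))"
      using assms(2) unfolding boundary_graph_def by blast
    then show "0 < r" "\<sigma> * \<sigma> = 1" "\<bar>\<sigma>\<bar> = 1" "C_holder_closure 2 \<alpha> (ball p r) \<gamma>"
      "x \<in> ball p r \<Longrightarrow> x \<in> D \<longleftrightarrow> 0 < \<sigma> * (x $ k - \<gamma> x)" for x
      by auto
    show "\<gamma> x = \<gamma> y" if "x \<in> ball p r" "y \<in> ball p r" "\<And>j. j \<noteq> k \<Longrightarrow> x $ j = y $ j" for x y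
      using assms(2) that unfolding boundary_graph_def by blast
  qed
  obtain G H where gh: "has_grad_hess (ball p r) \<gamma> G H"
    and cH: "\<And>i j. continuous_on (closure (ball p r)) (\<lambda>x. H x $ i $ j)"
    using C_holder_closure_2_grad_hess[OF open_ball C2] by metis
  obtain K where "0 < K"
    and K: "\<And>x. x \<in> ball p r \<Longrightarrow> \<bar>\<gamma> x - \<gamma> p - G p \<bullet> (x - p)\<bar> \<le> K * (norm (x - p))\<^sup>2"
    using second_order_taylor_bound[OF gh cH] by metis
  have pb: "p \<in> ball p r" using \<open>0 < r\<close> by simp
  have c\<gamma>: "continuous_on (ball p r) \<gamma>" by (rule has_grad_hess_imp_continuous_on(1)[OF gh])
  have d\<gamma>: "(\<gamma> has_derivative (\<lambda>v. G p \<bullet> v)) (at p)"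
    using gh pb by (simp add: has_grad_hess_def)
  have graph_frontier: "x \<in> frontier D" if x: "x \<in> ball p r" "x $ k = \<gamma> x" for x
  proof -
    have "x \<notin> D" using D[OF x(1)] x by simp
    moreover have "x \<in> closure D"
      unfolding closure_approachable
    proof (intro allI impI)
      fix e :: real assume "0 < e"
      define q where "q = min e (r - dist p x) / 2"
      have q: "0 < q" "q < e" "q < r - dist p x" using \<open>0 < e\<close> x by (auto simp: q_def)
      define y where "y = x + (q * \<sigma>) *\<^sub>R axis k 1"
      have dxy: "dist y x = q" using q \<sigma> by (simp add: y_def dist_norm abs_mult)
      have yb: "y \<in> ball p r" using dist_triangle[of p y x] dxy q by (simp add: dist_commute)
      have "\<gamma> y = \<gamma> x" by (rule indep[OF yb x(1)]) (simp add: y_def axis_def)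
      then have "\<sigma> * (y $ k - \<gamma> y) = q" using x \<sigma> by (simp add: y_def mult.left_commute)
      then have "y \<in> D" using D[OF yb] q by simp
      then show "\<exists>y\<in>D. dist y x < e" using dxy q by auto
    qed
    ultimately show ?thesis using \<open>open D\<close> by (simp add: frontier_def interior_open)
  qed
  have pk: "p $ k = \<gamma> p"
  proof (rule ccontr)
    assume "p $ k \<noteq> \<gamma> p"
    have "p \<notin> D" using assms(1,3) by (simp add: frontier_def interior_open)
    then have "\<sigma> * (p $ k - \<gamma> p) < 0"
      using D[OF pb] \<open>p $ k \<noteq> \<gamma> p\<close> \<sigma> by (auto simp: not_less order_less_le)
    moreover have "isCont (\<lambda>x. \<sigma> * (x $ k - \<gamma> x)) p"
      using c\<gamma> pb by (intro continuous_intros) (simp add: continuous_on_eq_continuous_at)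
    ultimately have "\<forall>\<^sub>F x in at p. \<sigma> * (x $ k - \<gamma> x) < 0"
      unfolding isCont_def by (rule order_tendstoD(2)[rotated])
    moreover have "\<forall>\<^sub>F x in at p. x \<in> ball p r"
      using pb by (intro eventually_at_in_open') auto
    ultimately have "\<forall>\<^sub>F x in at p. x \<notin> D"
      by eventually_elim (simp add: D)
    moreover have "p islimpt D" using assms(3) \<open>p \<notin> D\<close> by (auto simp: frontier_def closure_def)
    ultimately show False by (simp add: islimpt_conv_frequently_at frequently_def)
  qed
  define N where "N = \<sigma> *\<^sub>R (axis k 1 - G p)"
  have Gk: "G p $ k = 0"
  proof -
    have "((\<lambda>t. \<gamma> (p + t *\<^sub>R axis k 1)) has_real_derivative G p \<bullet> axis k 1) (at 0)"
      by (rule has_derivative_along_line) (simp add: d\<gamma>)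
    moreover have "((\<lambda>t. \<gamma> (p + t *\<^sub>R axis k 1)) has_real_derivative 0) (at 0)"
    proof -
      have "\<gamma> (p + t *\<^sub>R axis k 1) = \<gamma> p" if "\<bar>t\<bar> < r" for t
      proof (rule indep)
        show "p + t *\<^sub>R axis k 1 \<in> ball p r" using that by (simp add: dist_norm)
      qed (use pb in \<open>simp_all add: axis_def\<close>)
      then have "\<forall>\<^sub>F t in nhds 0. \<gamma> (p + t *\<^sub>R axis k 1) = \<gamma> p"
        unfolding eventually_nhds_metric using \<open>0 < r\<close> by (intro exI[of _ r]) auto
      then show ?thesis by (subst DERIV_cong_ev[OF refl _ refl]) auto
    qed
    ultimately have "G p \<bullet> axis k 1 = 0" by (rule DERIV_unique)
    then show ?thesis by (simp add: inner_axis)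
  qed
  have "N $ k = \<sigma>" by (simp add: N_def Gk)
  then have "N \<noteq> 0" using \<sigma> by auto
  then have nN: "0 < norm N" by simp
  define s where "s = min (r / (2 * norm N)) (1 / (2 * K))"
  have s: "0 < s" "s * (2 * norm N) \<le> r" "s * (2 * K) \<le> 1"
    using nN \<open>0 < r\<close> \<open>0 < K\<close>
    by (auto simp: s_def min_def field_simps split: if_splits)
  have ball: "ball (p + s *\<^sub>R N) (s * norm N) \<subseteq> D"
  proof
    fix x assume "x \<in> ball (p + s *\<^sub>R N) (s * norm N)"
    define d where "d = x - p"
    have "norm (d - s *\<^sub>R N) < norm (s *\<^sub>R N)"
      using \<open>x \<in> _\<close> s(1) by (simp add: d_def dist_norm norm_minus_commute algebra_simps)
    then have "(norm (d - s *\<^sub>R N))\<^sup>2 < (norm (s *\<^sub>R N))\<^sup>2" by (intro power_strict_mono) auto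
    then have dd: "(norm d)\<^sup>2 < 2 * s * (N \<bullet> d)"
      unfolding power2_norm_eq_inner by (simp add: inner_diff_left inner_diff_right inner_commute algebra_simps)
    have "norm d \<le> norm (d - s *\<^sub>R N) + norm (s *\<^sub>R N)"
      using norm_triangle_sub[of d "s *\<^sub>R N"] by simp
    also have "\<dots> < 2 * norm (s *\<^sub>R N)" using \<open>norm (d - s *\<^sub>R N) < norm (s *\<^sub>R N)\<close> by simp
    also have "\<dots> \<le> r" using s by simp
    finally have xb: "x \<in> ball p r" by (simp add: d_def dist_norm norm_minus_commute)
    define R where "R = \<gamma> x - \<gamma> p - G p \<bullet> d"
    have "\<bar>\<sigma> * R\<bar> \<le> K * (norm d)\<^sup>2" using K[OF xb] \<sigma> by (simp add: R_def d_def abs_mult)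
    moreover have "\<sigma> * (x $ k - \<gamma> x) = N \<bullet> d - \<sigma> * R"
      by (simp add: N_def R_def d_def pk inner_diff_left inner_axis' algebra_simps)
    moreover have "K * (norm d)\<^sup>2 < N \<bullet> d"
    proof -
      have "s * (2 * K) * (norm d)\<^sup>2 \<le> 1 * (norm d)\<^sup>2" using s by (intro mult_right_mono) auto
      then have "(2 * s) * (K * (norm d)\<^sup>2) < (2 * s) * (N \<bullet> d)" using dd by (simp add: algebra_simps)
      then show ?thesis using s by simp
    qed
    ultimately have "0 < \<sigma> * (x $ k - \<gamma> x)" by linarith
    then show "x \<in> D" using D[OF xb] by simp
  qed
  have curve: "\<exists>c. c 0 = p \<and> (\<forall>t. c t \<in> frontier D) \<and> (c has_vector_derivative \<tau>) (at (0::real))"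
    if "N \<bullet> \<tau> = 0" for \<tau>
  proof -
    have G\<tau>: "G p \<bullet> \<tau> = \<tau> $ k"
      using that \<sigma> by (auto simp: N_def inner_diff_left inner_axis')
    define c0 where "c0 = (\<lambda>t::real. p + t *\<^sub>R \<tau> + (\<gamma> (p + t *\<^sub>R \<tau>) - (p + t *\<^sub>R \<tau>) $ k) *\<^sub>R axis k 1)"
    have c00: "c0 0 = p" by (simp add: c0_def pk)
    have "((\<lambda>t. \<gamma> (p + t *\<^sub>R \<tau>)) has_real_derivative G p \<bullet> \<tau>) (at 0)"
      by (rule has_derivative_along_line) (simp add: d\<gamma>)
    then have d1: "((\<lambda>t. \<gamma> (p + t *\<^sub>R \<tau>)) has_derivative (\<lambda>t. t * \<tau> $ k)) (at 0)"
      by (simp add: has_field_derivative_def G\<tau> mult_commute_abs)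
    have "(c0 has_derivative (\<lambda>t. t *\<^sub>R \<tau>)) (at 0)"
    proof -
      have "((\<lambda>t. (p + t *\<^sub>R \<tau>) $ k) has_derivative (\<lambda>t. t * \<tau> $ k)) (at 0)"
        by (auto intro!: derivative_eq_intros)
      note shift = has_derivative_scaleR_left[OF has_derivative_diff[OF d1 this], of "axis k 1 :: real^'n"]
      have "((\<lambda>t. p + t *\<^sub>R \<tau>) has_derivative (\<lambda>t. t *\<^sub>R \<tau>)) (at 0)"
        by (auto intro!: derivative_eq_intros)
      from has_derivative_add[OF this shift] show ?thesis by (simp add: c0_def)
    qed
    then have c0': "(c0 has_vector_derivative \<tau>) (at 0)" by (simp add: has_vector_derivative_def)
    have "isCont c0 0" by (rule has_vector_derivative_continuous[OF c0'])
    then have "\<forall>\<^sub>F t in nhds 0. c0 t \<in> ball p r"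
      using pb c00 by (intro topological_tendstoD) (auto simp: isCont_def tendsto_at_iff_tendsto_nhds)
    moreover have "\<forall>\<^sub>F t in nhds (0::real). p + t *\<^sub>R \<tau> \<in> ball p r"
    proof (rule topological_tendstoD)
      show "((\<lambda>t. p + t *\<^sub>R \<tau>) \<longlongrightarrow> p + 0 *\<^sub>R \<tau>) (nhds 0)" by (intro tendsto_intros filterlim_ident)
    qed (use pb in auto)
    ultimately have "\<forall>\<^sub>F t in nhds 0. c0 t \<in> ball p r \<and> p + t *\<^sub>R \<tau> \<in> ball p r"
      by (rule eventually_conj)
    then obtain e where "e > 0" and e: "\<And>t. \<bar>t\<bar> < e \<Longrightarrow> c0 t \<in> ball p r \<and> p + t *\<^sub>R \<tau> \<in> ball p r"
      unfolding eventually_nhds_metric by auto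
    have fr: "c0 t \<in> frontier D" if "\<bar>t\<bar> < e" for t
    proof (rule graph_frontier)
      have "\<gamma> (c0 t) = \<gamma> (p + t *\<^sub>R \<tau>)"
        by (rule indep) (use e[OF that] in \<open>auto simp: c0_def axis_def\<close>)
      then show "c0 t $ k = \<gamma> (c0 t)" by (simp add: c0_def)
    qed (use e[OF that] in blast)
    \<comment> \<open>constant away from \<open>0\<close>, since curves must stay in the frontier for all times\<close>
    define c where "c = (\<lambda>t. if \<bar>t\<bar> < e then c0 t else p)"
    have "c 0 = p" using c00 by (simp add: c_def)
    moreover have "c t \<in> frontier D" for t using fr assms(3) by (simp add: c_def)
    moreover have "(c has_vector_derivative \<tau>) (at 0)"
      by (rule has_vector_derivative_transform_within[OF c0' \<open>e > 0\<close>]) (auto simp: c_def dist_norm)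
    ultimately show ?thesis by blast
  qed
  show ?thesis using that[OF \<open>N \<noteq> 0\<close> s(1) ball curve] .
qed

text \<open>A ray starting at a boundary point of a ball enters it in every direction that makes an acute angle with the
  inner normal.\<close>

lemma tangent_ray_in_ball:
  fixes N d :: "'a::real_inner"
  assumes "0 < s" "0 < N \<bullet> d"
  obtains T where "0 < T" "\<And>t. 0 < t \<Longrightarrow> t \<le> T \<Longrightarrow> p + t *\<^sub>R d \<in> ball (p + s *\<^sub>R N) (s * norm N)"
proof -
  have "d \<noteq> 0" using assms by auto
  define T where "T = s * (N \<bullet> d) / (d \<bullet> d)"
  have "0 < T" using assms \<open>d \<noteq> 0\<close> by (simp add: T_def)
  moreover have "p + t *\<^sub>R d \<in> ball (p + s *\<^sub>R N) (s * norm N)" if t: "0 < t" "t \<le> T" for t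
  proof -
    have "t * (d \<bullet> d) \<le> s * (N \<bullet> d)" using t \<open>d \<noteq> 0\<close> by (simp add: T_def pos_le_divide_eq)
    also have "\<dots> < 2 * s * (N \<bullet> d)" using assms by simp
    finally have "t * (t * (d \<bullet> d)) < t * (2 * s * (N \<bullet> d))" using t by simp
    then have "(norm (s *\<^sub>R N - t *\<^sub>R d))\<^sup>2 < (norm (s *\<^sub>R N))\<^sup>2"
      unfolding power2_norm_eq_inner by (simp add: inner_diff_left inner_diff_right inner_commute algebra_simps)
    then have "norm (s *\<^sub>R N - t *\<^sub>R d) < norm (s *\<^sub>R N)" by (rule power_less_imp_less_base) simp
    then show ?thesis using assms by (simp add: dist_norm)
  qed
  ultimately show ?thesis using that by blast
qed

lemma parallel_if_orthogonal_complement: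
  fixes N v :: "'a::real_inner"
  assumes "N \<noteq> 0" "\<And>\<tau>. N \<bullet> \<tau> = 0 \<Longrightarrow> v \<bullet> \<tau> = 0"
  obtains l where "v = l *\<^sub>R N"
proof -
  define l where "l = (N \<bullet> v) / (N \<bullet> N)"
  have "N \<bullet> (v - l *\<^sub>R N) = 0" using assms(1) by (simp add: l_def inner_diff_right)
  then have "(v - l *\<^sub>R N) \<bullet> (v - l *\<^sub>R N) = 0"
    using assms(2)[of "v - l *\<^sub>R N"] by (simp add: inner_diff_left)
  then show ?thesis using that[of l] by simp
qed

text \<open>Every \<open>\<tau>\<close> orthogonal to \<open>N\<close> is a limit of vectors \<open>\<tau> + q N\<close> of the open half-space, and the same applies
  to \<open>- \<tau>\<close>.\<close>

lemma orthogonal_if_halfspace_nonneg: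
  fixes N v :: "'a::real_inner"
  assumes "N \<noteq> 0" "\<And>d. 0 < N \<bullet> d \<Longrightarrow> 0 \<le> v \<bullet> d" "N \<bullet> \<tau> = 0"
  shows "v \<bullet> \<tau> = 0"
proof -
  have "0 \<le> v \<bullet> \<tau>" if \<tau>: "N \<bullet> \<tau> = 0" for \<tau>
  proof (rule field_le_epsilon)
    fix e :: real assume "0 < e"
    define q where "q = e / (\<bar>v \<bullet> N\<bar> + 1)"
    have "0 < q" using \<open>0 < e\<close> by (simp add: q_def)
    have "0 \<le> v \<bullet> (\<tau> + q *\<^sub>R N)"
      using assms(1) \<open>0 < q\<close> \<tau> by (intro assms(2)) (simp add: inner_add_right)
    moreover have "q * (v \<bullet> N) \<le> q * (\<bar>v \<bullet> N\<bar> + 1)" using \<open>0 < q\<close> by (intro mult_left_mono) auto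
    moreover have "q * (\<bar>v \<bullet> N\<bar> + 1) = e" unfolding q_def by (simp add: add_nonneg_pos)
    ultimately show "0 \<le> v \<bullet> \<tau> + e" by (simp add: inner_add_right)
  qed
  from this[of \<tau>] this[of "- \<tau>"] assms(3) show ?thesis by simp
qed

section \<open>Comparison of the two boundary value problems\<close>

lemma C2_real_lipschitz:
  assumes "C2_real F"
  obtains Q where "0 \<le> Q" "\<And>s t. s \<in> {0..M} \<Longrightarrow> t \<in> {0..M} \<Longrightarrow> \<bar>F s - F t\<bar> \<le> Q * \<bar>s - t\<bar>"
proof -
  obtain F' F'' where F: "\<And>t. (F has_real_derivative F' t) (at t)" "\<And>t. (F' has_real_derivative F'' t) (at t)"
    using assms unfolding C2_real_def by blast
  have "continuous_on {0..M} F'"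
    by (meson F(2) DERIV_isCont continuous_at_imp_continuous_on)
  then have "compact (F' ` {0..M})" by (intro compact_continuous_image) auto
  from compact_imp_bounded[OF this] obtain Q where Q: "\<forall>t\<in>{0..M}. \<bar>F' t\<bar> \<le> Q"
    by (auto simp: bounded_iff)
  have "\<bar>F s - F t\<bar> \<le> \<bar>Q\<bar> * \<bar>s - t\<bar>" if "s \<in> {0..M}" "t \<in> {0..M}" for s t
  proof -
    have "norm (F s - F t) \<le> \<bar>Q\<bar> * norm (s - t)"
    proof (rule field_differentiable_bound[where S = "{0..M}" and f' = F'])
      show "norm (F' z) \<le> \<bar>Q\<bar>" if "z \<in> {0..M}" for z
        using Q that by force
    qed (use that F(1) in \<open>auto intro: has_field_derivative_at_within\<close>)
    then show ?thesis by simp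
  qed
  then show ?thesis using that[of "\<bar>Q\<bar>"] by simp
qed

text \<open>Where \<open>u < 0\<close>, monotonicity gives \<open>F u \<ge> 0\<close>, that is \<open>L u \<le> 0\<close>; where \<open>u > M\<close> it gives \<open>F u \<le> 0\<close>, that is
  \<open>L (M - u) \<le> 0\<close>. So the weak minimum principle applies to \<open>u\<close> and to \<open>M - u\<close>.\<close>

lemma solution_bounds:
  assumes op: "elliptic_operator D a b c B" and "bounded D"
    and "continuous_on (closure D) u" "has_grad_hess D u G H"
    and pde: "\<And>x. x \<in> D \<Longrightarrow> elliptic_operator.L a b x (G x) (H x) = - F (u x)"
    and "antimono F" "F 0 = 0" "0 \<le> M" and bd: "\<And>x. x \<in> frontier D \<Longrightarrow> u x \<in> {0..M}"
    and "x \<in> closure D"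
  shows "u x \<in> {0..M}"
proof -
  interpret elliptic_operator D a b c B by (rule op)
  have "0 \<le> u x"
  proof (rule weak_minimum_principle[OF assms(2-4) _ _ \<open>x \<in> closure D\<close>])
    show "L z (G z) (H z) \<le> 0" if "z \<in> D" "u z < 0" for z
      unfolding pde[OF that(1)] using antimonoD[OF \<open>antimono F\<close>, of "u z" 0] \<open>F 0 = 0\<close> that by simp
    show "0 \<le> u z" if "z \<in> frontier D" for z using bd[OF that] by simp
  qed
  moreover have "0 \<le> -1 * u x + M"
  proof (rule weak_minimum_principle[OF assms(2) _ has_grad_hess_affine[OF assms(4)] _ _ \<open>x \<in> closure D\<close>])
    show "continuous_on (closure D) (\<lambda>x. -1 * u x + M)" by (intro continuous_intros assms)
    show "L z (-1 *\<^sub>R G z) (-1 *\<^sub>R H z) \<le> 0" if "z \<in> D" "-1 * u z + M < 0" for z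
      unfolding L_scale pde[OF that(1)]
      using antimonoD[OF \<open>antimono F\<close>, of 0 "u z"] \<open>F 0 = 0\<close> \<open>0 \<le> M\<close> that by simp
    show "0 \<le> -1 * u z + M" if "z \<in> frontier D" for z using bd[OF that] by simp
  qed
  ultimately show ?thesis by simp
qed

text \<open>This holds at every boundary point: the difference \<open>w\<close> of the solutions is positive in \<open>D\<close> and zero on the
  frontier, so its gradient at \<open>p\<close> is a nonzero multiple of the normal.\<close>

lemma conormal_derivatives_differ:
  fixes D :: "(real^'n::finite) set"
  assumes "open D" "connected D" "bounded D" "D \<noteq> {}"
    and bdry: "C2_holder_boundary \<alpha> D"
    and C2: "\<And>i j. C_closure 2 D (\<lambda>x. a x $ i $ j)"
    and sym: "\<And>x i j. x \<in> closure D \<Longrightarrow> a x $ i $ j = a x $ j $ i"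
    and "0 < c" and ell: "\<And>x \<xi>. x \<in> closure D \<Longrightarrow> c * (norm \<xi>)\<^sup>2 \<le> \<xi> \<bullet> (a x *v \<xi>)"
    and p: "p \<in> frontier D" and \<nu>: "outward_unit_normal D p (\<nu> p)"
    and F1: "C2_real F1" "antimono F1" "F1 0 = 0" and F2: "antimono F2" "F2 0 = 0"
    and u1: "solves_dirichlet \<alpha> a D F1 h u1" and u2: "solves_dirichlet \<alpha> a D F2 h u2"
    and h: "h ` frontier D = {0..M}" and "0 \<le> M"
    and ge: "\<And>t. t \<in> {0..M} \<Longrightarrow> F2 t \<le> F1 t" and ne: "t \<in> {0..M}" "F1 t \<noteq> F2 t"
    and contF: "continuous_on {0..M} (\<lambda>t. F1 t - F2 t)"
  shows "conormal_derivative a D \<nu> u1 p \<noteq> conormal_derivative a D \<nu> u2 p"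
proof -
  obtain b B where op: "elliptic_operator D a b c B"
    and div: "\<And>u G H x. has_grad_hess D u G H \<Longrightarrow> x \<in> D \<Longrightarrow>
       div_operator a u x = - elliptic_operator.L a b x (G x) (H x)"
    using div_operator_nondivergence_form[OF assms(1,3,4) C2 sym \<open>0 < c\<close> ell] by blast
  interpret elliptic_operator D a b c B by (rule op)
  obtain G1 H1 where c1: "continuous_on (closure D) u1" "continuous_on (closure D) G1"
    and gh1: "has_grad_hess D u1 G1 H1"
    using C_holder_closure_2_grad_hess[OF \<open>open D\<close>] u1 unfolding solves_dirichlet_def by metis
  obtain G2 H2 where c2: "continuous_on (closure D) u2" "continuous_on (closure D) G2"
    and gh2: "has_grad_hess D u2 G2 H2"
    using C_holder_closure_2_grad_hess[OF \<open>open D\<close>] u2 unfolding solves_dirichlet_def by metis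
  have pde1: "L x (G1 x) (H1 x) = - F1 (u1 x)" if "x \<in> D" for x
    using u1 that div[OF gh1 that] by (simp add: solves_dirichlet_def)
  have pde2: "L x (G2 x) (H2 x) = - F2 (u2 x)" if "x \<in> D" for x
    using u2 that div[OF gh2 that] by (simp add: solves_dirichlet_def)
  have bd: "u1 x = h x" "u2 x = h x" "h x \<in> {0..M}" if "x \<in> frontier D" for x
    using u1 u2 h that by (auto simp: solves_dirichlet_def)
  have r1: "u1 x \<in> {0..M}" if "x \<in> closure D" for x
    by (rule solution_bounds[OF op \<open>bounded D\<close> c1(1) gh1 pde1 F1(2,3) \<open>0 \<le> M\<close> _ that])
      (use bd in auto)
  have r2: "u2 x \<in> {0..M}" if "x \<in> closure D" for x
    by (rule solution_bounds[OF op \<open>bounded D\<close> c2(1) gh2 pde2 F2 \<open>0 \<le> M\<close> _ that])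
      (use bd in auto)
  define w where "w = (\<lambda>x. u1 x - u2 x)"
  define G where "G = (\<lambda>x. G1 x - G2 x)"
  define H where "H = (\<lambda>x. H1 x - H2 x)"
  have gh: "has_grad_hess D w G H"
    unfolding w_def G_def H_def by (rule has_grad_hess_diff[OF gh1 gh2])
  have cw: "continuous_on (closure D) w" unfolding w_def by (intro continuous_intros c1 c2)
  have cG: "continuous_on (closure D) G" unfolding G_def by (intro continuous_intros c1 c2)
  have Lw: "L x (G x) (H x) = F1 (u2 x) - F1 (u1 x) - (F1 (u2 x) - F2 (u2 x))" if "x \<in> D" for x
    by (simp add: G_def H_def L_diff pde1[OF that] pde2[OF that])
  have inD: "x \<in> closure D" if "x \<in> D" for x using that closure_subset by blast
  have w0: "w x = 0" if "x \<in> frontier D" for x using bd[OF that] by (simp add: w_def)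
  have wnn: "0 \<le> w x" if "x \<in> closure D" for x
  proof (rule weak_minimum_principle[OF \<open>bounded D\<close> cw gh _ _ that])
    show "L z (G z) (H z) \<le> 0" if "z \<in> D" "w z < 0" for z
      using antimonoD[OF F1(2), of "u1 z" "u2 z"] ge[OF r2[OF inD[OF that(1)]]] that
      by (simp add: Lw w_def)
  qed (simp add: w0)
  obtain Q where "0 \<le> Q" and Q: "\<And>s t. s \<in> {0..M} \<Longrightarrow> t \<in> {0..M} \<Longrightarrow> \<bar>F1 s - F1 t\<bar> \<le> Q * \<bar>s - t\<bar>"
    using C2_real_lipschitz[OF F1(1)] by metis
  have super: "L x (G x) (H x) \<le> Q * w x" if "x \<in> D" for x
    using Q[OF r2 r1, OF inD inD, OF that that] wnn[OF inD[OF that]] ge[OF r2[OF inD[OF that]]]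
    by (simp add: Lw[OF that] w_def abs_minus_commute abs_of_nonneg)
  \<comment> \<open>if \<open>w\<close> vanished in \<open>D\<close>, so would \<open>F1 (u2 x) - F2 (u2 x)\<close>, and by continuity this would extend to the
  boundary point where \<open>u2\<close> has the value \<open>t\<close>\<close>
  obtain x1 where x1: "x1 \<in> D" "0 < w x1"
  proof (rule ccontr)
    assume no: "\<not> thesis"
    then have wz: "w x = 0" if "x \<in> D" for x
      using wnn[OF inD[OF that]] \<open>\<And>x1. x1 \<in> D \<Longrightarrow> 0 < w x1 \<Longrightarrow> thesis\<close> that by force
    have Fz: "F1 (u2 x) - F2 (u2 x) = 0" if "x \<in> D" for x
    proof -
      have "0 \<le> L x (G x) (H x)"
        by (rule L_nonneg_at_min[OF \<open>open D\<close> _ gh that]) (use wz that in auto)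
      moreover have "u1 x = u2 x" using wz[OF that] by (simp add: w_def)
      ultimately show ?thesis using Lw[OF that] ge[OF r2[OF inD[OF that]]] by simp
    qed
    obtain y where y: "y \<in> frontier D" "h y = t" using h ne(1) by (metis imageE)
    have "F1 (u2 y) - F2 (u2 y) = 0"
    proof (rule continuous_constant_on_closure[of D "\<lambda>x. F1 (u2 x) - F2 (u2 x)"])
      show "continuous_on (closure D) (\<lambda>x. F1 (u2 x) - F2 (u2 x))"
        by (rule continuous_on_compose2[OF contF c2(1)]) (use r2 in blast)
      show "y \<in> closure D" using y by (simp add: frontier_def)
    qed (rule Fz)
    then show False using bd(2)[OF y(1)] y(2) ne(2) by simp
  qed
  have wpos: "0 < w x" if "x \<in> D" for x
    by (rule strong_minimum_principle[OF \<open>connected D\<close> cw gh wnn[OF inD] super \<open>0 \<le> Q\<close> x1 that])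
  obtain r k \<sigma> \<gamma> where bg: "boundary_graph \<alpha> D p r k \<sigma> \<gamma>"
    using bdry p unfolding C2_holder_boundary_def by blast
  obtain N s where "N \<noteq> 0" "0 < s" and ball: "ball (p + s *\<^sub>R N) (s * norm N) \<subseteq> D"
    and tangent: "\<And>\<tau>. N \<bullet> \<tau> = 0 \<Longrightarrow>
      \<exists>c. c 0 = p \<and> (\<forall>t. c t \<in> frontier D) \<and> (c has_vector_derivative \<tau>) (at (0::real))"
    using boundary_graph_normal[OF \<open>open D\<close> bg p] by blast
  have pcl: "p \<in> closure D" using p by (simp add: frontier_def)
  have tG: "(G \<longlongrightarrow> G p) (at p within D)"
    using cG pcl closure_subset unfolding continuous_on_def by (blast intro: tendsto_within_subset)
  have sN: "0 < s * norm N" using \<open>N \<noteq> 0\<close> \<open>0 < s\<close> by simp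
  have sph: "sphere (p + s *\<^sub>R N) (s * norm N) \<subseteq> closure D"
    using closure_mono[OF ball] sN by (auto simp: closure_ball)
  have "0 < G p \<bullet> ((p + s *\<^sub>R N) - p)"
  proof (rule hopf_gradient[OF sN ball cw gh _ _ _ \<open>0 \<le> Q\<close> _ w0[OF p] tG])
    show "p \<in> sphere (p + s *\<^sub>R N) (s * norm N)" using \<open>0 < s\<close> by (simp add: dist_norm)
  qed (use super wpos wnn ball sph in blast)+
  then have "G p \<noteq> 0" by auto
  have "0 \<le> G p \<bullet> d" if d: "0 < N \<bullet> d" for d
  proof -
    obtain T where T: "0 < T" "\<And>t. 0 < t \<Longrightarrow> t \<le> T \<Longrightarrow> p + t *\<^sub>R d \<in> ball (p + s *\<^sub>R N) (s * norm N)"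
      using tangent_ray_in_ball[OF \<open>0 < s\<close> d] by metis
    have pD: "p \<notin> D" using p \<open>open D\<close> by (simp add: frontier_def interior_open)
    have ray: "p + t *\<^sub>R d \<in> D" if "0 < t" "t \<le> T" for t using T(2)[OF that] ball by blast
    show ?thesis
    proof (rule le_directional_derivative[OF cw tG _ T(1)])
      show "(w has_derivative (\<bullet>) (G x)) (at x)" if "x \<in> D" for x
        using gh that by (simp add: has_grad_hess_def)
      show "p + t *\<^sub>R d \<in> D - {p}" if "0 < t" "t \<le> T" for t using ray[OF that] pD by auto
      show "w p + 0 * t \<le> w (p + t *\<^sub>R d)" if "0 < t" "t \<le> T" for t
        using wpos[OF ray[OF that]] w0[OF p] by simp
    qed (use closure_subset pcl in auto)
  qed
  then have "G p \<bullet> \<tau> = 0" if "N \<bullet> \<tau> = 0" for \<tau>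
    using orthogonal_if_halfspace_nonneg[OF \<open>N \<noteq> 0\<close>] that by blast
  then obtain l where l: "G p = l *\<^sub>R N"
    using parallel_if_orthogonal_complement[OF \<open>N \<noteq> 0\<close>] by metis
  have "\<nu> p \<bullet> \<tau> = 0" if "N \<bullet> \<tau> = 0" for \<tau>
    using tangent[OF that] \<nu> unfolding outward_unit_normal_def by blast
  then obtain m where m: "\<nu> p = m *\<^sub>R N"
    using parallel_if_orthogonal_complement[OF \<open>N \<noteq> 0\<close>] by metis
  have "norm (\<nu> p) = 1" using \<nu> unfolding outward_unit_normal_def by blast
  then have "m \<noteq> 0" using m by auto
  have "l \<noteq> 0" using l \<open>G p \<noteq> 0\<close> by auto
  have conormal: "conormal_derivative a D \<nu> u p = \<nu> p \<bullet> (a p *v G' p)"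
    if "continuous_on (closure D) G'" "has_grad_hess D u G' H'" for u G' H'
    unfolding conormal_derivative_def Lim_partial_eq_gradient[OF \<open>open D\<close> that p]
    by (simp add: inner_vec_def matrix_vector_mult_def sum_distrib_left mult_ac)
  have "conormal_derivative a D \<nu> u1 p - conormal_derivative a D \<nu> u2 p = \<nu> p \<bullet> (a p *v G p)"
    by (simp add: conormal[OF c1(2) gh1] conormal[OF c2(2) gh2] G_def matrix_vector_mult_diff_distrib
        inner_diff_right)
  also have "\<dots> = m * l * (N \<bullet> (a p *v N))"
    by (simp add: l m matrix_vector_mult_scaleR)
  also have "\<dots> \<noteq> 0"
  proof -
    have "0 < c * (norm N)\<^sup>2" using \<open>0 < c\<close> \<open>N \<noteq> 0\<close> by simp
    then show ?thesis using ell[OF pcl, of N] \<open>m \<noteq> 0\<close> \<open>l \<noteq> 0\<close> by simp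
  qed
  finally show ?thesis by simp
qed

theorem theorem2p1:
  fixes \<Omega> :: "(real^'n::finite) set"
    and a :: "real^'n \<Rightarrow> real^'n^'n"
    and g :: "real^'n \<Rightarrow> real"
    and \<nu> :: "real^'n \<Rightarrow> real^'n"
    and \<alpha> R \<delta>\<^sub>0 :: real
    and F\<^sub>1 F\<^sub>2 :: "real \<Rightarrow> real"
    and u\<^sub>1 u\<^sub>2 :: "real \<Rightarrow> real^'n \<Rightarrow> real"
    and x\<^sub>0 :: "real^'n"
  assumes "2 \<le> CARD('n)"
    and "0 < \<alpha>" "\<alpha> < 1"
    and "open \<Omega>" "connected \<Omega>" "bounded \<Omega>" "\<Omega> \<noteq> {}"
    and "C2_holder_boundary \<alpha> \<Omega>"
    and "\<And>i j. C_closure 2 \<Omega> (\<lambda>x. a x $ i $ j)"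
    and "\<And>x i j. x \<in> closure \<Omega> \<Longrightarrow> a x $ i $ j = a x $ j $ i"
    and "\<exists>c>0. \<forall>x\<in>closure \<Omega>. \<forall>\<xi>::real^'n.
           c * (norm \<xi>)\<^sup>2 \<le> (\<Sum>i\<in>UNIV. \<Sum>j\<in>UNIV. a x $ i $ j * \<xi> $ i * \<xi> $ j)"
    and "C2_holder_on_boundary \<alpha> \<Omega> g"
    and "0 < R" "g ` frontier \<Omega> = {0..R}"
    and "\<And>x. x \<in> frontier \<Omega> \<Longrightarrow> outward_unit_normal \<Omega> x (\<nu> x)"
    and "C2_real F\<^sub>1" "antimono F\<^sub>1" "F\<^sub>1 0 = 0"
    and "C2_real F\<^sub>2" "antimono F\<^sub>2" "F\<^sub>2 0 = 0"
    and "\<And>\<delta>. \<delta> \<in> {0..1} \<Longrightarrow> solves_dirichlet \<alpha> a \<Omega> F\<^sub>1 (\<lambda>x. \<delta> * g x) (u\<^sub>1 \<delta>)"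
    and "\<And>\<delta>. \<delta> \<in> {0..1} \<Longrightarrow> solves_dirichlet \<alpha> a \<Omega> F\<^sub>2 (\<lambda>x. \<delta> * g x) (u\<^sub>2 \<delta>)"
    and "x\<^sub>0 \<in> frontier \<Omega>"
    and "\<delta>\<^sub>0 \<in> {0<..1}"
    and "\<And>\<delta>. \<delta> \<in> {0..\<delta>\<^sub>0} \<Longrightarrow>
           conormal_derivative a \<Omega> \<nu> (u\<^sub>1 \<delta>) x\<^sub>0 = conormal_derivative a \<Omega> \<nu> (u\<^sub>2 \<delta>) x\<^sub>0"
  shows "changes_sign_infinitely_often (\<lambda>t. F\<^sub>1 t - F\<^sub>2 t) {0..\<delta>\<^sub>0 * R} \<or>
         (\<forall>t\<in>{0..\<delta>\<^sub>0 * R}. F\<^sub>1 t = F\<^sub>2 t)"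
proof (rule ccontr)
  assume "\<not> ?thesis"
  then obtain t where nosc: "\<not> changes_sign_infinitely_often (\<lambda>t. F\<^sub>1 t - F\<^sub>2 t) {0..\<delta>\<^sub>0 * R}"
    and t: "t \<in> {0..\<delta>\<^sub>0 * R}" "F\<^sub>1 t - F\<^sub>2 t \<noteq> 0" by auto
  have F0: "F\<^sub>1 0 - F\<^sub>2 0 = 0" using assms by simp
  obtain s where s: "0 < s" "s \<le> \<delta>\<^sub>0 * R" "\<exists>t\<in>{0..s}. F\<^sub>1 t - F\<^sub>2 t \<noteq> 0"
    "(\<forall>t\<in>{0..s}. 0 \<le> F\<^sub>1 t - F\<^sub>2 t) \<or> (\<forall>t\<in>{0..s}. F\<^sub>1 t - F\<^sub>2 t \<le> 0)"
    using one_sign_near_zero[of "\<lambda>t. F\<^sub>1 t - F\<^sub>2 t", OF F0 nosc t] by blast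
  define \<delta> where "\<delta> = s / R"
  have \<delta>: "0 < \<delta>" "\<delta> \<le> \<delta>\<^sub>0" "\<delta> * R = s"
    using s assms(13) by (auto simp: \<delta>_def pos_divide_le_eq)
  have \<delta>01: "\<delta> \<in> {0..1}" "\<delta> \<in> {0..\<delta>\<^sub>0}" using \<delta> assms(25) by auto
  have img: "(\<lambda>x. \<delta> * g x) ` frontier \<Omega> = {0..s}"
  proof -
    have "(\<lambda>x. \<delta> * g x) ` frontier \<Omega> = (\<lambda>y. \<delta> * y) ` {0..R}"
      unfolding assms(14)[symmetric] image_image ..
    also have "\<dots> = {0..s}" using \<delta> assms(13) by (simp add: image_mult_atLeastAtMost)
    finally show ?thesis .
  qed
  have contF: "continuous_on S F" if "C2_real F" for F and S :: "real set"
    using that unfolding C2_real_def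
    by (meson DERIV_isCont continuous_at_imp_continuous_on)
  obtain c where c: "0 < c" "\<And>x \<xi>. x \<in> closure \<Omega> \<Longrightarrow> c * (norm \<xi>)\<^sup>2 \<le> \<xi> \<bullet> (a x *v \<xi>)"
    using assms(11) unfolding quadratic_form_eq by blast
  note differ = conormal_derivatives_differ[where a = a and \<nu> = \<nu>, OF assms(4-10) c assms(24) assms(15)[OF assms(24)]]
  have eq: "conormal_derivative a \<Omega> \<nu> (u\<^sub>1 \<delta>) x\<^sub>0 = conormal_derivative a \<Omega> \<nu> (u\<^sub>2 \<delta>) x\<^sub>0"
    by (rule assms(26)[OF \<delta>01(2)])
  obtain q where q: "q \<in> {0..s}" "F\<^sub>1 q \<noteq> F\<^sub>2 q" using s(3) by auto
  from s(4) show False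
  proof
    assume sign: "\<forall>t\<in>{0..s}. 0 \<le> F\<^sub>1 t - F\<^sub>2 t"
    have "conormal_derivative a \<Omega> \<nu> (u\<^sub>1 \<delta>) x\<^sub>0 \<noteq> conormal_derivative a \<Omega> \<nu> (u\<^sub>2 \<delta>) x\<^sub>0"
    proof (rule differ[OF _ _ assms(16-18,20,21) assms(22,23)[OF \<delta>01(1)] img _ _ q])
      show "continuous_on {0..s} (\<lambda>t. F\<^sub>1 t - F\<^sub>2 t)"
        by (intro continuous_on_diff contF assms(16,19))
    qed (use s(1) sign in auto)
    then show False using eq by simp
  next
    assume sign: "\<forall>t\<in>{0..s}. F\<^sub>1 t - F\<^sub>2 t \<le> 0"
    have "conormal_derivative a \<Omega> \<nu> (u\<^sub>2 \<delta>) x\<^sub>0 \<noteq> conormal_derivative a \<Omega> \<nu> (u\<^sub>1 \<delta>) x\<^sub>0"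
    proof (rule differ[OF _ _ assms(19-21,17,18) assms(23,22)[OF \<delta>01(1)] img _ _ q(1) q(2)[symmetric]])
      show "continuous_on {0..s} (\<lambda>t. F\<^sub>2 t - F\<^sub>1 t)"
        by (intro continuous_on_diff contF assms(16,19))
    qed (use s(1) sign in auto)
    then show False using eq by simp
  qed
qed

end
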